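(* Let $0<\alpha<1$ and consider the problem described in the context with the thermal conductivity $k$ unknown (Case 3), the data $\rho,c,\ell>0$, $T_m$, $T_0>T_m$, $q_0>0$ being given. For any such data, the equation $$\frac{x\left[1-W\left(-x;-\frac{\alpha}{2},1\right)\right]}{M_{\alpha/2}(x)}=\frac{c(T_0-T_m)\,\Gamma\left(1-\frac{\alpha}{2}\right)}{\ell\,\Gamma\left(1+\frac{\alpha}{2}\right)},\quad x>0,$$ has a unique solution $\xi_\alpha>0$, and the solution of Case 3 is given by $$k=k_\alpha=\frac{q_0^2\,\Gamma^2\left(1-\frac{\alpha}{2}\right)}{\rho c(T_0-T_m)^2}\left[1-W\left(-\xi_\alpha;-\frac{\alpha}{2},1\right)\right]^2,$$ $$T_\alpha(x,t)=T_0-\frac{T_0-T_m}{1-W\left(-\xi_\alpha;-\frac{\alpha}{2},1\right)}\left[1-W\left(-\frac{x}{\lambda_\alpha t^{\alpha/2}};-\frac{\alpha}{2},1\right)\right],\qquad s_\alpha(t)=\lambda_\alpha\xi_\alpha t^{\alpha/2},$$ where $$\lambda_\alpha=\frac{q_0\,\Gamma\left(1-\frac{\alpha}{2}\right)}{\rho c(T_0-T_m)}\left[1-W\left(-\xi_\alpha;-\frac{\alpha}{2},1\right)\right].$$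
   Context: For $0<\alpha<1$ the Caputo fractional derivative of a function $f$ of $t$ is $D^\alpha f(t)=\frac{1}{\Gamma(1-\alpha)}\int_0^t \frac{f'(\tau)}{(t-\tau)^\alpha}\,d\tau$, where $\Gamma$ is Euler's Gamma function. The Wright function is $W(z;a,b)=\sum_{n=0}^{\infty}\frac{z^n}{n!\,\Gamma(na+b)}$ for $z\in\mathbb{C}$, $a>-1$, $b\in\mathbb{R}$; the Mainardi function is $M_\nu(z)=W(-z;-\nu,1-\nu)$ for $\nu<1$. The problem: $\rho,k,c,\ell$ are positive constants (density, conductivity, specific heat, latent heat), $\lambda^2=k/(\rho c)$, $T_m$ is the melting temperature, $T_0>T_m$ and $q_0>0$ are constants. Find $x=s(t)$, $T=T(x,t)$ and the unknown coefficient such that: $D^\alpha T=\lambda^2 T_{xx}$ for $0<x<s(t)$, $t>0$ (Caputo derivative in $t$); $s(0)=0$; $T(x,0)=T(+\infty,t)=T_m$ for $x>0,t>0$; $T(s(t),t)=T_m$; $-kT_x(s(t),t)=\rho\ell\, D^\alpha s(t)$; $T(0,t)=T_0$; $kT_x(0,t)=-q_0/t^{\alpha/2}$, for all $t>0$.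
   Formalization: The conditions T(x,0)=T(+∞,t)=T_m are imposed on the temperature set equal to T_m for x≥s(t), since the closed formula T_α tends to a value below T_m as x→∞ or t→0+; the diffusion equation uses the closed formula at all earlier times. "The solution" is read as "a solution". *)

theory Defs
  imports "HOL-Analysis.Analysis"
begin

text \<open>Wright function W(z;a,b) = sum_n z^n / (n! Gamma(n a + b)) (real argument).
  At poles of Gamma, Isabelle's Gamma is 0 and x/0 = 0, matching 1/Gamma = 0 there.\<close>
definition Wright :: "real \<Rightarrow> real \<Rightarrow> real \<Rightarrow> real" where
  "Wright z a b = (\<Sum>n. z ^ n / (fact n * Gamma (real n * a + b)))"

definition Mainardi :: "real \<Rightarrow> real \<Rightarrow> real" where
  "Mainardi \<nu> z = Wright (- z) (- \<nu>) (1 - \<nu>)"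

definition has_caputo_deriv :: "real \<Rightarrow> (real \<Rightarrow> real) \<Rightarrow> real \<Rightarrow> real \<Rightarrow> bool" where
  "has_caputo_deriv \<alpha> f t D \<longleftrightarrow>
     (\<forall>\<tau>\<in>{0<..<t}. f differentiable (at \<tau>)) \<and>
     ((\<lambda>\<tau>. deriv f \<tau> / (t - \<tau>) powr \<alpha>) has_integral (Gamma (1 - \<alpha>) * D)) {0..t}"

text \<open>Temperature of the whole half-line: liquid temperature T in 0 \<le> x < s(t),
  solid at melting temperature Tm for x \<ge> s(t).\<close>
definition full_temp :: "(real \<Rightarrow> real) \<Rightarrow> (real \<Rightarrow> real \<Rightarrow> real) \<Rightarrow> real \<Rightarrow> real \<Rightarrow> real \<Rightarrow> real" where
  "full_temp s T Tm x t = (if x < s t then T x t else Tm)"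

definition stefan_problem ::
  "real \<Rightarrow> real \<Rightarrow> real \<Rightarrow> real \<Rightarrow> real \<Rightarrow> real \<Rightarrow> real \<Rightarrow> real
     \<Rightarrow> (real \<Rightarrow> real \<Rightarrow> real) \<Rightarrow> (real \<Rightarrow> real) \<Rightarrow> bool" where
  "stefan_problem \<alpha> \<rho> k c ell Tm T0 q0 T s \<longleftrightarrow>
     (\<forall>t>0. \<forall>x. 0 < x \<and> x < s t \<longrightarrow>
        (\<forall>y\<in>{0<..<s t}. (\<lambda>y. T y t) differentiable (at y)) \<and>
        (\<exists>D. has_caputo_deriv \<alpha> (\<lambda>\<tau>. T x \<tau>) t D \<and>
             (deriv (\<lambda>y. T y t) has_real_derivative D / (k / (\<rho> * c))) (at x))) \<and>
     s 0 = 0 \<and>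
     (\<forall>x>0. full_temp s T Tm x 0 = Tm) \<and>
     (\<forall>t>0. ((\<lambda>x. full_temp s T Tm x t) \<longlongrightarrow> Tm) at_top) \<and>
     (\<forall>t>0. T (s t) t = Tm) \<and>
     (\<forall>t>0. \<exists>Tx Ds. ((\<lambda>y. T y t) has_real_derivative Tx) (at (s t) within {0..s t}) \<and>
             has_caputo_deriv \<alpha> s t Ds \<and> - k * Tx = \<rho> * ell * Ds) \<and>
     (\<forall>t>0. T 0 t = T0) \<and>
     (\<forall>t>0. ((\<lambda>y. T y t) has_real_derivative (- q0 / t powr (\<alpha> / 2) / k)) (at 0 within {0..s t}))"

end

theory Submission
  imports Defs "HOL-Complex_Analysis.Complex_Analysis" "HOL-Real_Asymp.Real_Asymp"
begin

text \<open>Put \<open>\<nu> = \<alpha> / 2\<close>. Integrating the power series termwise (reflection formula for \<open>\<Gamma>\<close>) gives, for \<open>b < 1\<close>,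
  \[ \pi\, t^{b-1} W(-x t^{-\nu}; -\nu, b) = \int_0^\infty e^{-tp} p^{-b} e^{-x p^\nu \cos \pi\nu} \sin(\pi b + x p^\nu \sin \pi\nu)\, dp . \]
  The Stieltjes transform of the kernel is a residue, so for \<open>0 \<le> b < 1\<close> the left-hand side divided by \<open>\<pi>\<close> has
  Laplace transform \<open>s\<^sup>-\<^sup>b exp (- x s\<^sup>\<nu>)\<close>. Two consequences carry the theorem. By uniqueness of the Laplace
  transform, fractional integration of order \<open>1 - \<alpha>\<close> turns \<open>b = 0\<close> into \<open>b = 1 - \<alpha>\<close>, which is the diffusion
  equation for the similarity solution. And since \<open>exp (- x s\<^sup>\<nu>)\<close> is completely monotone, the case \<open>b = 0\<close>,
  which is a positive multiple of \<open>M\<^sub>\<nu>\<close>, is nonnegative; so are its fractional integrals, among them \<open>- M\<^sub>\<nu>'\<close>.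
  Hence \<open>M\<^sub>\<nu>\<close> is positive and decreasing, and the left-hand side of the equation for \<open>\<xi>\<close> increases strictly
  from \<open>0\<close> to \<open>\<infinity>\<close>.\<close>

section \<open>Complete monotonicity and the Laplace transform\<close>

text \<open>The series of \<open>stable_density \<nu> 0 x\<close> consists of powers t^(-1 - n
  \<nu>), none of them integrable at 0, so neither its Laplace transform nor its fractional integral
  can be computed term by term; nor does an alternating series reveal a sign. Written as a mixture
  of exponentials in \<open>t\<close>, the density has a Laplace transform at once, and both the
  sign and the fractional integral are read off from that transform. Termwise work survives only for
  the mixture itself, where every power of \<open>p\<close> that occurs is integrable at 0 because b
  < 1. The kernel is what the inverse Laplace integral of s^(-b) exp (- x s^\<nu>) leaves when its
  contour is folded onto the negative axis; only the converse direction is checked. The bound \<nu>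
  < 1/2 has two effects. It makes cos (pi \<nu>) positive, so that the kernel decays by itself and
  the density stays bounded near t = 0. And it keeps the parameter 1 - 2 \<nu> of the second space
  derivative positive, so that this derivative is a fractional integral of a nonnegative
  function.\<close>

abbreviation halfline :: "real measure" where
  "halfline \<equiv> restrict_space lborel {0<..}"

lemma halfline_measurable [measurable (raw)]:
  "f \<in> borel_measurable borel \<Longrightarrow> f \<in> borel_measurable halfline"
  by (simp add: measurable_restrict_space1)

lemma integrable_halfline_iff:
  fixes f :: "real \<Rightarrow> 'a::{banach, second_countable_topology}"
  shows "integrable halfline f \<longleftrightarrow> integrable lborel (\<lambda>x. indicator {0<..} x *\<^sub>R f x)"
  by (subst integrable_restrict_space) auto

lemma integral_halfline_eq:
  fixes f :: "real \<Rightarrow> 'a::{banach, second_countable_topology}"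
  shows "integral\<^sup>L halfline f = integral\<^sup>L lborel (\<lambda>x. indicator {0<..} x *\<^sub>R f x)"
  by (subst integral_restrict_space) auto

lemma sigma_finite_halfline: "sigma_finite_measure halfline"
  by (rule sigma_finite_measure_restrict_space) (auto intro: lborel.sigma_finite_measure_axioms)

interpretation halfline_pair: pair_sigma_finite halfline halfline
  by (intro pair_sigma_finite.intro sigma_finite_halfline)

lemma AE_halfline: "(\<And>x. 0 < x \<Longrightarrow> P x) \<Longrightarrow> AE x in halfline. P x"
  by (rule AE_I2) (simp add: space_restrict_space)

section \<open>Gamma integrals on the half-line\<close>

lemma powr_exp_integral_halfline:
  fixes z t :: real
  assumes "0 < z" "0 < t"
  shows "has_bochner_integral halfline (\<lambda>p. p powr (z - 1) * exp (- (t * p))) (Gamma z / t powr z)"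
proof -
  let ?f = "\<lambda>p. p powr (z - 1) / exp p :: real"
  have *: "(?f has_integral Gamma z) {0<..}"
    using Gamma_integral_real[OF assms(1)]
    by (subst has_integral_spike_set_eq[of _ "{0..}"]) (auto intro: negligible_subset[of "{0}"])
  hence "?f absolutely_integrable_on {0<..}"
    by (intro nonnegative_absolutely_integrable_1) auto
  hence i: "set_integrable lborel {0<..} ?f"
    by (auto simp: set_integrable_def integrable_completion)
  have v: "set_lebesgue_integral lborel {0<..} ?f = Gamma z"
    using set_borel_integral_eq_integral(2)[OF i] * by (simp add: integral_unique)
  have "has_bochner_integral lborel (\<lambda>x. indicator {0<..} x *\<^sub>R ?f x) (Gamma z)"
    using i v by (simp add: has_bochner_integral_iff set_integrable_def set_lebesgue_integral_def)
  hence "has_bochner_integral lborel (\<lambda>x. indicator {0<..} (0 + t * x) *\<^sub>R ?f (0 + t * x)) (Gamma z /\<^sub>R \<bar>t\<bar>)"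
    using assms by (subst (asm) lborel_has_bochner_integral_real_affine_iff[of t _ _ 0]) auto
  hence "has_bochner_integral lborel (\<lambda>x. (1 / t powr (z - 1)) *\<^sub>R
      (indicator {0<..} (0 + t * x) *\<^sub>R ?f (0 + t * x))) ((1 / t powr (z - 1)) *\<^sub>R (Gamma z /\<^sub>R \<bar>t\<bar>))"
    by (rule has_bochner_integral_scaleR_right) 
  also have "(\<lambda>x. (1 / t powr (z - 1)) *\<^sub>R (indicator {0<..} (0 + t * x) *\<^sub>R ?f (0 + t * x)))
     = (\<lambda>p. indicator {0<..} p *\<^sub>R (p powr (z - 1) * exp (- (t * p))))"
    using assms by (auto simp: fun_eq_iff indicator_def zero_less_mult_iff powr_mult exp_minus field_simps)
  also have "(1 / t powr (z - 1)) *\<^sub>R (Gamma z /\<^sub>R \<bar>t\<bar>) = Gamma z / t powr z"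
    using assms by (simp add: powr_diff field_simps)
  finally show ?thesis
    by (simp add: has_bochner_integral_iff integrable_halfline_iff integral_halfline_eq)
qed

lemma powr_le_linear:
  fixes x t \<nu> :: real
  assumes "0 < \<nu>" "\<nu> < 1" "0 < t" "0 \<le> x"
  obtains C where "\<And>p. 0 < p \<Longrightarrow> x * p powr \<nu> \<le> t * p + C"
proof -
  \<comment> \<open>\<open>P\<close> is where \<open>x * p powr \<nu>\<close> and
    \<open>t * p\<close> cross: to the right the line dominates, to the left the value at
    \<open>P\<close> serves as the constant.\<close>
  define P where "P = (x / t) powr (1 / (1 - \<nu>))"
  have "x * p powr \<nu> \<le> t * p + x * P powr \<nu>" if p: "0 < p" for p
  proof (cases "p \<le> P")
    case True
    hence "p powr \<nu> \<le> P powr \<nu>" using p assms by (intro powr_mono2) auto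
    hence "x * p powr \<nu> \<le> x * P powr \<nu>" using assms by (intro mult_left_mono) auto
    thus ?thesis using assms p by (smt (verit) mult_pos_pos)
  next
    case False
    have "x / t = P powr (1 - \<nu>)"
      using assms by (cases "x = 0") (auto simp: P_def powr_powr)
    also have "\<dots> \<le> p powr (1 - \<nu>)" using False assms p
      by (intro powr_mono2) (auto simp: P_def)
    finally have "x * p powr \<nu> \<le> t * p powr (1 - \<nu>) * p powr \<nu>"
      using assms by (intro mult_right_mono) (auto simp: field_simps)
    also have "\<dots> = t * p" using p by (simp add: powr_add[symmetric] mult.assoc)
    finally show ?thesis using assms by (smt (verit) mult_nonneg_nonneg powr_ge_zero)
  qed
  thus ?thesis by (rule that)
qed

text \<open>Half of the decay \<open>exp (- (t * p))\<close> absorbs the growing exponential up to a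
  constant; the other half leaves a Gamma integrand.\<close>

lemma powr_exp_powr_integrable:
  fixes x t \<nu> z :: real
  assumes "0 < \<nu>" "\<nu> < 1" "0 < t" "0 \<le> x" "0 < z"
  shows "integrable halfline (\<lambda>p. p powr (z - 1) * exp (- (t * p)) * exp (x * p powr \<nu>))"
proof -
  obtain C where C: "\<And>p. 0 < p \<Longrightarrow> x * p powr \<nu> \<le> t / 2 * p + C"
    using powr_le_linear[of \<nu> "t/2" x] assms by auto
  show ?thesis
  proof (rule Bochner_Integration.integrable_bound)
    show "integrable halfline (\<lambda>p. exp C * (p powr (z - 1) * exp (- (t/2 * p))))"
      using powr_exp_integral_halfline[of z "t/2"] assms
      by (intro integrable_mult_right) (simp add: has_bochner_integral_iff)
    show "AE p in halfline. norm (p powr (z - 1) * exp (- (t * p)) * exp (x * p powr \<nu>))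
       \<le> norm (exp C * (p powr (z - 1) * exp (- (t/2 * p))))"
    proof (rule AE_halfline)
      fix p :: real assume p: "0 < p"
      have "exp (- (t * p)) * exp (x * p powr \<nu>) \<le> exp C * exp (- (t/2 * p))"
        using C[OF p] by (simp add: exp_add[symmetric])
      hence "p powr (z - 1) * (exp (- (t * p)) * exp (x * p powr \<nu>)) \<le> p powr (z - 1) * (exp C * exp (- (t/2 * p)))"
        by (intro mult_left_mono) auto
      thus "norm (p powr (z - 1) * exp (- (t * p)) * exp (x * p powr \<nu>))
       \<le> norm (exp C * (p powr (z - 1) * exp (- (t/2 * p))))"
        by (simp add: mult_ac abs_mult)
    qed
  qed measurable
qed

text \<open>The terms are integrals of the terms of an exponential series, so the partial sums stay
  below one convergent integral and no growth estimate for Gamma is needed. With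
  \<open>t = 1\<close> this majorizes the Wright series, with general \<open>t\<close> the termwise
  integration of the kernel.\<close>

lemma summable_Gamma_over_fact:
  fixes x t \<nu> z :: real
  assumes \<nu>: "0 < \<nu>" "\<nu> < 1" and t: "0 < t" and x: "0 \<le> x" and z: "0 < z"
  shows "summable (\<lambda>n. x ^ n / fact n * (Gamma (\<nu> * real n + z) / t powr (\<nu> * real n + z)))"
proof (rule summableI_nonneg_bounded)
  let ?f = "\<lambda>n p. x ^ n / fact n * (p powr (\<nu> * real n + z - 1) * exp (- (t * p)))"
  let ?G = "\<lambda>p. p powr (z - 1) * exp (- (t * p)) * exp (x * p powr \<nu>)"
  have f: "has_bochner_integral halfline (?f n) (x ^ n / fact n * (Gamma (\<nu> * real n + z) / t powr (\<nu> * real n + z)))" for n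
    using assms by (intro has_bochner_integral_mult_right powr_exp_integral_halfline) (auto intro: add_nonneg_pos)
  show "0 \<le> x ^ n / fact n * (Gamma (\<nu> * real n + z) / t powr (\<nu> * real n + z))" for n
    using assms by (intro mult_nonneg_nonneg divide_nonneg_nonneg less_imp_le[OF Gamma_real_pos]) (auto intro: add_nonneg_pos)
  fix n
  have "(\<Sum>k<n. x ^ k / fact k * (Gamma (\<nu> * real k + z) / t powr (\<nu> * real k + z)))
     = (\<integral>p. (\<Sum>k<n. ?f k p) \<partial>halfline)"
    using f by (subst Bochner_Integration.integral_sum) (auto simp: has_bochner_integral_iff)
  also have "\<dots> \<le> (\<integral>p. ?G p \<partial>halfline)"
  proof (rule integral_mono_AE)
    show "integrable halfline (\<lambda>p. \<Sum>k<n. ?f k p)"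
      using f by (intro Bochner_Integration.integrable_sum) (auto simp: has_bochner_integral_iff)
    show "integrable halfline ?G" by (rule powr_exp_powr_integrable) fact+
    show "AE p in halfline. (\<Sum>k<n. ?f k p) \<le> ?G p"
    proof (rule AE_halfline)
      fix p :: real assume p: "0 < p"
      have eq: "?f k p = p powr (z - 1) * exp (- (t * p)) * ((x * p powr \<nu>) ^ k /\<^sub>R fact k)" for k
        using p by (simp add: powr_add powr_diff power_mult_distrib powr_powr[symmetric] powr_realpow field_simps)
      have "(\<Sum>k<n. (x * p powr \<nu>) ^ k /\<^sub>R fact k) \<le> exp (x * p powr \<nu>)"
        unfolding exp_def using assms by (intro sum_le_suminf summable_exp_generic) auto
      thus "(\<Sum>k<n. ?f k p) \<le> ?G p"
        unfolding eq sum_distrib_left[symmetric] by (intro mult_left_mono) auto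
    qed
  qed
  finally show "(\<Sum>k<n. x ^ k / fact k * (Gamma (\<nu> * real k + z) / t powr (\<nu> * real k + z))) \<le> (\<integral>p. ?G p \<partial>halfline)" .
qed

text \<open>The reciprocal form includes the poles: there \<open>Gamma y\<close> is 0 by convention,
  so the left side is 0, and the sine vanishes as well.\<close>

lemma rGamma_reflection:
  fixes y :: real
  assumes "y < 1"
  shows "1 / Gamma y = Gamma (1 - y) * sin (pi * y) / pi"
proof (cases "y \<in> \<int>\<^sub>\<le>\<^sub>0")
  case True
  then obtain n where "y = - of_nat n" by (auto elim: nonpos_Ints_cases')
  hence "sin (pi * y) = 0" by (simp add: mult.commute)
  with True show ?thesis by (simp add: Gamma_eq_zero_iff)
next
  case False
  have "Gamma y * Gamma (1 - y) = pi / sin (pi * y)" 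
  proof -
    have "complex_of_real (Gamma y * Gamma (1 - y)) = complex_of_real (pi / sin (pi * y))"
      using Gamma_reflection_complex[of "complex_of_real y"]
      by (simp add: Gamma_complex_of_real[symmetric] sin_of_real[symmetric])
    thus ?thesis by (simp only: of_real_eq_iff)
  qed
  moreover have "Gamma y \<noteq> 0" using False by (simp add: Gamma_eq_zero_iff)
  moreover have "Gamma (1 - y) \<noteq> 0" using assms by (intro less_imp_neq[symmetric] Gamma_real_pos) auto
  ultimately show ?thesis by (cases "sin (pi * y) = 0") (auto simp: field_simps)
qed

text \<open>Complete monotonicity on the positive axis, with \<open>D n = (-1)\<^sup>n f\<^sup>(\<^sup>n\<^sup>)\<close>.\<close>

definition alternating_derivs :: "(real \<Rightarrow> real) \<Rightarrow> bool" where
  "alternating_derivs f \<longleftrightarrow> (\<exists>D. D 0 = f \<and>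
     (\<forall>n s. 0 < s \<longrightarrow> (D n has_real_derivative - D (Suc n) s) (at s) \<and> 0 \<le> D n s))"

lemma alternating_derivs_nonneg: "alternating_derivs f \<Longrightarrow> 0 < s \<Longrightarrow> 0 \<le> f s"
  unfolding alternating_derivs_def by blast

text \<open>Every \<open>D n\<close> is decreasing, so differencing keeps all signs. On the other
  side of the Laplace transform this difference is multiplication by
  \<open>1 - exp (- t)\<close>.\<close>

lemma alternating_derivs_diff:
  assumes "alternating_derivs f"
  shows "alternating_derivs (\<lambda>s. f s - f (s + 1))"
proof -
  obtain D where D0: "D 0 = f" and
    D: "\<And>n s. 0 < s \<Longrightarrow> (D n has_real_derivative - D (Suc n) s) (at s)" "\<And>n s. 0 < s \<Longrightarrow> 0 \<le> D n s"
    using assms unfolding alternating_derivs_def by blast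
  have "((\<lambda>s. D n s - D n (s + 1)) has_real_derivative - (D (Suc n) s - D (Suc n) (s + 1))) (at s)"
    if "0 < s" for n s
    using that by (auto intro!: derivative_eq_intros D(1) DERIV_chain2[OF D(1)])
  moreover have "D n (s + 1) \<le> D n s" if "0 < s" for n s
  proof (rule DERIV_nonpos_imp_nonincreasing[of s "s + 1"])
    fix u assume "s \<le> u"
    hence "0 < u" using that by linarith
    thus "\<exists>y. (D n has_real_derivative y) (at u) \<and> y \<le> 0"
      using D by (intro exI[of _ "- D (Suc n) u"]) auto
  qed simp
  ultimately show ?thesis
    unfolding alternating_derivs_def using D0
    by (intro exI[of _ "\<lambda>n s. D n s - D n (s + 1)"]) auto
qed

text \<open>The signed derivatives of a function with \<open>f' = - H 0 * f\<close>, where \<open>H k\<close> is \<open>(-1)\<^sup>k\<close> times the \<open>k\<close>-th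
  derivative of \<open>H 0\<close>.\<close>

fun leibniz_exp :: "(nat \<Rightarrow> real \<Rightarrow> real) \<Rightarrow> (real \<Rightarrow> real) \<Rightarrow> nat \<Rightarrow> real \<Rightarrow> real" where
  "leibniz_exp H f 0 s = f s"
| "leibniz_exp H f (Suc n) s = (\<Sum>k\<le>n. real (n choose k) * H k s * leibniz_exp H f (n - k) s)"

text \<open>Leibniz's rule for \<open>f' = - H 0 * f\<close> yields a recursion with nonnegative
  terms only, so the signs come for free; the work lies in showing that the recursion produces the
  derivatives.\<close>

lemma alternating_derivs_logderiv:
  assumes f: "\<And>s. 0 < s \<Longrightarrow> (f has_real_derivative - (H 0 s * f s)) (at s)" "\<And>s. 0 < s \<Longrightarrow> 0 \<le> f s"
    and H: "\<And>n s. 0 < s \<Longrightarrow> (H n has_real_derivative - H (Suc n) s) (at s)" "\<And>n s. 0 < s \<Longrightarrow> 0 \<le> H n s"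
  shows "alternating_derivs f"
proof -
  let ?D = "leibniz_exp H f"
  have nn: "0 \<le> ?D n s" if "0 < s" for n s
    using that
  proof (induction n rule: less_induct)
    case (less n)
    thus ?case using f(2) H(2) by (cases n) (auto intro!: sum_nonneg mult_nonneg_nonneg)
  qed
  have der: "(?D n has_real_derivative - ?D (Suc n) s) (at s)" if s: "0 < s" for n s
  proof (induction n rule: less_induct)
    case (less n)
    show ?case
    proof (cases n)
      case 0
      have "?D 0 = f" by auto
      thus ?thesis using f(1)[OF s] 0 by simp
    next
      case (Suc m)
      let ?c = "\<lambda>k. real (m choose k)"
      have "((\<lambda>s. \<Sum>k\<le>m. ?c k * H k s * ?D (m - k) s) has_real_derivative
         (\<Sum>k\<le>m. ?c k * (- H (Suc k) s) * ?D (m - k) s + ?c k * H k s * (- ?D (Suc (m - k)) s))) (at s)"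
      proof (rule DERIV_sum)
        fix k assume "k \<in> {..m}"
        show "((\<lambda>s. ?c k * H k s * ?D (m - k) s) has_real_derivative 
           ?c k * (- H (Suc k) s) * ?D (m - k) s + ?c k * H k s * (- ?D (Suc (m - k)) s)) (at s)"
          using DERIV_mult[OF DERIV_cmult[OF H(1)[OF s, of k], of "?c k"] less[of "m - k"]] Suc
          by (simp add: algebra_simps)
      qed
      moreover have "(\<Sum>k\<le>m. ?c k * (- H (Suc k) s) * ?D (m - k) s + ?c k * H k s * (- ?D (Suc (m - k)) s))
         = - ?D (Suc n) s"
      proof -
        let ?a = "\<lambda>k. H k s * ?D (Suc m - k) s"
        have "?D (Suc n) s = (\<Sum>k\<le>Suc m. real (Suc m choose k) * ?a k)"
          by (simp only: Suc leibniz_exp.simps mult.assoc)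
        also have "\<dots> = ?a 0 + (\<Sum>k\<le>m. real (Suc m choose Suc k) * ?a (Suc k))"
          by (subst sum.atMost_Suc_shift) simp
        \<comment> \<open>Pascal's rule separates the terms where \<open>H\<close> is differentiated
          from those where the other factor is.\<close>
        also have "(\<Sum>k\<le>m. real (Suc m choose Suc k) * ?a (Suc k)) = 
            (\<Sum>k\<le>m. ?c k * ?a (Suc k)) + (\<Sum>k\<le>m. ?c (Suc k) * ?a (Suc k))"
          by (simp only: binomial_Suc_Suc of_nat_add distrib_right sum.distrib)
        also have "?a 0 + ((\<Sum>k\<le>m. ?c k * ?a (Suc k)) + (\<Sum>k\<le>m. ?c (Suc k) * ?a (Suc k)))
            = (\<Sum>k\<le>m. ?c k * ?a (Suc k)) + (\<Sum>k\<le>Suc m. ?c k * ?a k)"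
          using sum.atMost_Suc_shift[of "\<lambda>k. ?c k * ?a k" m] by (simp del: leibniz_exp.simps sum.atMost_Suc)
        \<comment> \<open>The top term drops because \<open>m choose Suc m\<close> is 0.\<close>
        also have "(\<Sum>k\<le>Suc m. ?c k * ?a k) = (\<Sum>k\<le>m. ?c k * ?a k)"
          by simp
        also have "\<dots> = (\<Sum>k\<le>m. ?c k * H k s * ?D (Suc (m - k)) s)"
          by (intro sum.cong refl) (auto simp: Suc_diff_le simp del: leibniz_exp.simps)
        also have "(\<Sum>k\<le>m. ?c k * ?a (Suc k)) = (\<Sum>k\<le>m. ?c k * H (Suc k) s * ?D (m - k) s)"
          by (intro sum.cong refl) (simp del: leibniz_exp.simps)
        finally show ?thesis
          by (simp add: sum.distrib sum_negf sum_subtractf del: leibniz_exp.simps)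
      qed
      moreover have "?D n = (\<lambda>s. \<Sum>k\<le>m. ?c k * H k s * ?D (m - k) s)"
        using Suc by auto
      ultimately show ?thesis by simp
    qed
  qed
  have "?D 0 = f" by auto
  with nn der show ?thesis unfolding alternating_derivs_def by (intro exI[of _ ?D]) auto
qed

lemma alternating_derivs_exp_powr:
  fixes x \<nu> :: real
  assumes "0 < \<nu>" "\<nu> < 1" "0 \<le> x"
  shows "alternating_derivs (\<lambda>s. exp (- (x * s powr \<nu>)))"
proof (rule alternating_derivs_logderiv)
  \<comment> \<open>The derivative of \<open>x * s powr \<nu>\<close> and its signed derivatives.
    Each differentiation brings down \<open>\<nu> - 1 - real k\<close>, and the sign changes turn
    these factors into a rising factorial, nonnegative since \<open>\<nu> < 1\<close>.\<close>
  let ?H = "\<lambda>k s. x * \<nu> * pochhammer (1 - \<nu>) k * s powr (\<nu> - 1 - real k)"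
  show "((\<lambda>s. exp (- (x * s powr \<nu>))) has_real_derivative - (?H 0 s * exp (- (x * s powr \<nu>)))) (at s)"
    if "0 < s" for s using that by (auto intro!: derivative_eq_intros)
  show "0 \<le> exp (- (x * s powr \<nu>))" for s by simp
  show "(?H n has_real_derivative - ?H (Suc n) s) (at s)" if "0 < s" for n s
    using that by (auto intro!: derivative_eq_intros simp: pochhammer_Suc algebra_simps)
  show "0 \<le> ?H n s" for n s
    using assms by (intro mult_nonneg_nonneg pochhammer_nonneg) auto
qed

section \<open>Positivity and uniqueness from the Laplace transform\<close>

lemma laplace_binomial:
  fixes g :: "real \<Rightarrow> real" and F :: "real \<Rightarrow> real"
  assumes L: "\<And>s. 0 < s \<Longrightarrow> has_bochner_integral halfline (\<lambda>t. exp (- (s * t)) * g t) (F s)"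
    and F: "alternating_derivs F" and s: "0 < s"
  shows "integrable halfline (\<lambda>t. exp (- (s * t)) * (1 - exp (- t)) ^ m * g t)"
    and "0 \<le> (\<integral>t. exp (- (s * t)) * (1 - exp (- t)) ^ m * g t \<partial>halfline)"
proof -
  \<comment> \<open>The induction carries a transform known at every positive argument, because each
    new factor \<open>1 - exp (- t)\<close> also evaluates it at \<open>s + 1\<close>.\<close>
  have "\<exists>F. alternating_derivs F \<and> (\<forall>s>0. has_bochner_integral halfline (\<lambda>t. exp (- (s * t)) * (1 - exp (- t)) ^ m * g t) (F s))"
  proof (induction m)
    case 0 thus ?case using L F by auto
  next
    case (Suc m)
    then obtain F where F: "alternating_derivs F" and
      L: "\<And>s. 0 < s \<Longrightarrow> has_bochner_integral halfline (\<lambda>t. exp (- (s * t)) * (1 - exp (- t)) ^ m * g t) (F s)"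
      by blast
    have "has_bochner_integral halfline (\<lambda>t. exp (- (s * t)) * (1 - exp (- t)) ^ Suc m * g t) (F s - F (s + 1))"
      if "0 < s" for s
    proof -
      have "has_bochner_integral halfline (\<lambda>t. exp (- (s * t)) * (1 - exp (- t)) ^ m * g t -
           exp (- ((s + 1) * t)) * (1 - exp (- t)) ^ m * g t) (F s - F (s + 1))"
        using that by (intro has_bochner_integral_diff L) auto
      moreover have "exp (- (s * t)) * (1 - exp (- t)) ^ m * g t -
           exp (- ((s + 1) * t)) * (1 - exp (- t)) ^ m * g t = exp (- (s * t)) * (1 - exp (- t)) ^ Suc m * g t" for t
      proof -
        have "exp (- ((s + 1) * t)) = exp (- (s * t)) * exp (- t)"
          by (simp add: exp_add[symmetric] algebra_simps)
        thus ?thesis by (simp add: algebra_simps)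
      qed
      ultimately show ?thesis by simp
    qed
    with alternating_derivs_diff[OF F] show ?case by blast
  qed
  then obtain F where "alternating_derivs F" "has_bochner_integral halfline (\<lambda>t. exp (- (s * t)) * (1 - exp (- t)) ^ m * g t) (F s)"
    using s by blast
  thus "integrable halfline (\<lambda>t. exp (- (s * t)) * (1 - exp (- t)) ^ m * g t)"
    and "0 \<le> (\<integral>t. exp (- (s * t)) * (1 - exp (- t)) ^ m * g t \<partial>halfline)"
    using alternating_derivs_nonneg s by (auto simp: has_bochner_integral_iff)
qed

text \<open>Approximate \<open>\<phi>\<close> by Bernstein polynomials in \<open>exp (- t)\<close>: their integrals are iterated differences of \<open>F\<close>.\<close>

lemma laplace_nonneg_test:
  fixes g :: "real \<Rightarrow> real" and F :: "real \<Rightarrow> real" and \<phi> :: "real \<Rightarrow> real"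
  assumes L: "\<And>s. 0 < s \<Longrightarrow> has_bochner_integral halfline (\<lambda>t. exp (- (s * t)) * g t) (F s)"
    and F: "alternating_derivs F"
    and \<phi>: "continuous_on UNIV \<phi>" "\<And>y. 0 \<le> \<phi> y"
  shows "integrable halfline (\<lambda>t. \<phi> (exp (- t)) * (exp (- t) * g t))"
    and "0 \<le> (\<integral>t. \<phi> (exp (- t)) * (exp (- t) * g t) \<partial>halfline)"
proof -
  have i: "integrable halfline (\<lambda>t. exp (- t) * g t)"
    using L[of 1] by (simp add: has_bochner_integral_iff)
  have gm [measurable]: "(\<lambda>t. exp (- t) * g t) \<in> borel_measurable halfline" using i by auto
  have [measurable]: "\<phi> \<in> borel_measurable borel" using \<phi> by (simp add: borel_measurable_continuous_onI)
  have \<phi>m: "(\<lambda>t. \<phi> (exp (- t))) \<in> borel_measurable halfline" by measurable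
  have "bounded (\<phi> ` {0..1})"
    by (intro compact_imp_bounded compact_continuous_image continuous_on_subset[OF \<phi>(1)]) auto
  then obtain B where "\<forall>x\<in>\<phi> ` {0..1}. norm x \<le> B"
    unfolding bounded_iff by blast
  hence B: "\<And>y. y \<in> {0..1} \<Longrightarrow> \<bar>\<phi> y\<bar> \<le> B" by auto
  show ii: "integrable halfline (\<lambda>t. \<phi> (exp (- t)) * (exp (- t) * g t))"
  proof (rule Bochner_Integration.integrable_bound)
    show "integrable halfline (\<lambda>t. B * (exp (- t) * g t))" using i by (rule integrable_mult_right)
    show "AE t in halfline. norm (\<phi> (exp (- t)) * (exp (- t) * g t)) \<le> norm (B * (exp (- t) * g t))"
    proof (rule AE_halfline)
      fix t :: real assume "0 < t"
      hence "\<bar>\<phi> (exp (- t))\<bar> \<le> \<bar>B\<bar>" using B[of "exp (- t)"] by force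
      thus "norm (\<phi> (exp (- t)) * (exp (- t) * g t)) \<le> norm (B * (exp (- t) * g t))"
        unfolding norm_mult by (intro mult_right_mono) auto
    qed
    show "(\<lambda>t. \<phi> (exp (- t)) * (exp (- t) * g t)) \<in> borel_measurable halfline"
      using \<phi>m gm by (rule borel_measurable_times)
  qed
  let ?K = "\<integral>t. \<bar>exp (- t) * g t\<bar> \<partial>halfline"
  show "0 \<le> (\<integral>t. \<phi> (exp (- t)) * (exp (- t) * g t) \<partial>halfline)"
  proof (rule field_le_epsilon)
    fix e :: real assume e: "0 < e"
    \<comment> \<open>The uniform error is integrated against \<open>exp (- t) * g t\<close>, so it
      must be small relative to the L1 norm \<open>?K\<close>; adding 1 covers
      \<open>?K = 0\<close>.\<close>
    define d where "d = e / (?K + 1)"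
    have K: "0 \<le> ?K" by (rule integral_nonneg_AE) auto
    have d: "0 < d" using e K unfolding d_def by (intro divide_pos_pos) linarith+
    have "continuous_on {0..1} \<phi>" using \<phi>(1) by (rule continuous_on_subset) simp
    from Bernstein_Weierstrass[OF this d] obtain n where
      n: "\<And>y. y \<in> {0..1} \<Longrightarrow> \<bar>\<phi> y - (\<Sum>k\<le>n. \<phi> (k/n) * Bernstein n k y)\<bar> < d"
      by blast
    \<comment> \<open>The factor \<open>exp (- t) ^ k\<close> of the Bernstein polynomial and the
      fixed weight \<open>exp (- t)\<close> combine to the transform at \<open>k + 1\<close>, a
      positive argument even for \<open>k = 0\<close>.\<close>
    let ?b = "\<lambda>k t. \<phi> (k/n) * real (n choose k) * (exp (- ((real k + 1) * t)) * (1 - exp (- t)) ^ (n - k) * g t)"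
    let ?P = "\<lambda>t. (\<Sum>k\<le>n. \<phi> (k/n) * Bernstein n k (exp (- t))) * (exp (- t) * g t)"
    have P: "?P t = (\<Sum>k\<le>n. ?b k t)" for t
    proof -
      have "exp (- ((real k + 1) * t)) = exp (- t) ^ k * exp (- t)" for k
        by (simp add: exp_of_nat_mult[symmetric] exp_add[symmetric] algebra_simps)
      thus ?thesis
        unfolding sum_distrib_right Bernstein_def by (simp only: mult_ac)
    qed
    have bi: "integrable halfline (?b k)" for k
      using laplace_binomial(1)[OF L F, of "real k + 1" "n - k"] by (intro integrable_mult_right) auto
    have Pi: "integrable halfline ?P" unfolding P by (intro Bochner_Integration.integrable_sum bi)
    have "0 \<le> (\<Sum>k\<le>n. \<integral>t. ?b k t \<partial>halfline)"
    proof (rule sum_nonneg)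
      fix k
      show "0 \<le> (\<integral>t. ?b k t \<partial>halfline)"
        using laplace_binomial(2)[OF L F, of "real k + 1" "n - k"] \<phi>(2)[of "k/n"]
        by (subst integral_mult_right_zero) (intro mult_nonneg_nonneg, auto)
    qed
    also have "\<dots> = (\<integral>t. ?P t \<partial>halfline)"
      unfolding P by (rule Bochner_Integration.integral_sum[symmetric]) (rule bi)
    also have "\<dots> \<le> (\<integral>t. \<phi> (exp (- t)) * (exp (- t) * g t) + d * \<bar>exp (- t) * g t\<bar> \<partial>halfline)"
    proof (rule integral_mono_AE[OF Pi])
      show "integrable halfline (\<lambda>t. \<phi> (exp (- t)) * (exp (- t) * g t) + d * \<bar>exp (- t) * g t\<bar>)"
        by (rule Bochner_Integration.integrable_add[OF ii integrable_mult_right[OF integrable_abs[OF i]]])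
      show "AE t in halfline. ?P t \<le> \<phi> (exp (- t)) * (exp (- t) * g t) + d * \<bar>exp (- t) * g t\<bar>"
      proof (rule AE_halfline)
        fix t :: real assume "0 < t"
        let ?S = "\<Sum>k\<le>n. \<phi> (k/n) * Bernstein n k (exp (- t))"
        have "(?S - \<phi> (exp (- t))) * (exp (- t) * g t) \<le> \<bar>?S - \<phi> (exp (- t))\<bar> * \<bar>exp (- t) * g t\<bar>"
          unfolding abs_mult[symmetric] by (rule abs_ge_self)
        also have "\<dots> \<le> d * \<bar>exp (- t) * g t\<bar>"
          using n[of "exp (- t)"] \<open>0 < t\<close> by (intro mult_right_mono) (simp_all add: abs_minus_commute)
        finally show "?P t \<le> \<phi> (exp (- t)) * (exp (- t) * g t) + d * \<bar>exp (- t) * g t\<bar>"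
          by (simp add: left_diff_distrib)
      qed
    qed
    also have "\<dots> = (\<integral>t. \<phi> (exp (- t)) * (exp (- t) * g t) \<partial>halfline) + d * ?K"
      by (subst Bochner_Integration.integral_add[OF ii integrable_mult_right[OF integrable_abs[OF i]]])
         (simp only: integral_mult_right_zero)
    also have "d * ?K \<le> d * (?K + 1)" using d by (intro mult_left_mono) auto
    also have "d * (?K + 1) = e" using K unfolding d_def by (subst nonzero_eq_divide_eq[symmetric]) linarith+
    finally show "0 \<le> (\<integral>t. \<phi> (exp (- t)) * (exp (- t) * g t) \<partial>halfline) + e" by - simp
  qed
qed

text \<open>A bump supported where \<open>g\<close> is negative would have a negative integral
  against \<open>g\<close>; continuity provides an interval for it.\<close>

lemma laplace_alternating_imp_nonneg:
  fixes g :: "real \<Rightarrow> real" and F :: "real \<Rightarrow> real"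
  assumes L: "\<And>s. 0 < s \<Longrightarrow> has_bochner_integral halfline (\<lambda>t. exp (- (s * t)) * g t) (F s)"
    and F: "alternating_derivs F"
    and g: "continuous_on {0<..} g" and t: "0 < t"
  shows "0 \<le> g t"
proof (rule ccontr)
  assume "\<not> 0 \<le> g t"
  hence neg: "g t < 0" by simp
  have "isCont g t" using g t by (simp add: continuous_on_eq_continuous_at)
  then obtain \<epsilon> where \<epsilon>: "0 < \<epsilon>" "\<And>u. \<bar>u - t\<bar> < \<epsilon> \<Longrightarrow> g u < 0"
  proof -
    have "eventually (\<lambda>u. g u < 0) (at t)"
      using \<open>isCont g t\<close> neg unfolding isCont_def by (rule order_tendstoD(2))
    then obtain \<epsilon> where "0 < \<epsilon>" "\<And>u. u \<noteq> t \<Longrightarrow> \<bar>u - t\<bar> < \<epsilon> \<Longrightarrow> g u < 0"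
      by (auto simp: eventually_at dist_real_def)
    thus ?thesis using neg that by metis
  qed
  \<comment> \<open>Capping at \<open>t\<close> keeps the interval inside the positive axis.\<close>
  define \<delta> where "\<delta> = min \<epsilon> t"
  have \<delta>: "0 < \<delta>" "\<delta> \<le> t" "\<delta> \<le> \<epsilon>" using \<epsilon> t by (auto simp: \<delta>_def)
  define a b where "a = exp (- (t + \<delta>))" and "b = exp (- (t - \<delta>))"
  \<comment> \<open>A parabola cut off at 0; its zeros are the images under \<open>exp (- u)\<close>
    of the two ends of the interval.\<close>
  define \<phi> where "\<phi> = (\<lambda>y. max 0 ((y - a) * (b - y)))"
  have \<phi>pos: "0 < \<phi> (exp (- u)) \<longleftrightarrow> \<bar>u - t\<bar> < \<delta>" for u
    using \<delta> by (auto simp: \<phi>_def a_def b_def less_max_iff_disj zero_less_mult_iff)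
  have \<phi>nn: "0 \<le> \<phi> y" for y by (simp add: \<phi>_def)
  have \<phi>cont: "continuous_on UNIV \<phi>" unfolding \<phi>_def by (intro continuous_intros)
  let ?h = "\<lambda>t. \<phi> (exp (- t)) * (exp (- t) * g t)"
  note i = laplace_nonneg_test[OF L F \<phi>cont \<phi>nn]
  have le: "?h u \<le> 0" for u
  proof (cases "0 < \<phi> (exp (- u))")
    case True
    hence "g u < 0" using \<epsilon>(2) \<delta> by (auto simp: \<phi>pos)
    with True show ?thesis by (simp add: mult_le_0_iff)
  next
    case False
    hence "\<phi> (exp (- u)) = 0" using \<phi>nn[of "exp (- u)"] by linarith
    thus ?thesis by simp
  qed
  have "(\<integral>u. - ?h u \<partial>halfline) = 0"
  proof (rule antisym)
    show "0 \<le> (\<integral>u. - ?h u \<partial>halfline)" using le by (intro integral_nonneg_AE) auto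
    show "(\<integral>u. - ?h u \<partial>halfline) \<le> 0" using i(2) by simp
  qed
  hence "AE u in halfline. - ?h u = 0"
    using le i(1) by (subst (asm) integral_nonneg_eq_0_iff_AE) auto
  hence "AE u in lborel. 0 < u \<longrightarrow> ?h u = 0"
    by (subst (asm) AE_restrict_space_iff) auto
  hence "AE u in lborel. \<not> (u \<in> {t - \<delta><..<t + \<delta>})"
  proof eventually_elim
    case (elim u)
    show ?case
    proof
      assume u: "u \<in> {t - \<delta><..<t + \<delta>}"
      hence "\<bar>u - t\<bar> < \<delta>" "0 < u" using \<delta> by auto
      hence "0 < \<phi> (exp (- u))" "g u < 0" "0 < u" using \<phi>pos \<epsilon>(2) \<delta> by auto
      with elim show False by simp
    qed
  qed
  hence "emeasure lborel {t - \<delta><..<t + \<delta>} = 0"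
    by (subst (asm) AE_iff_measurable[of "{t - \<delta><..<t + \<delta>}"]) auto
  thus False using \<delta> by simp
qed

text \<open>Lerch's theorem for continuous functions. The difference has transform 0, which is
  trivially alternating, so positivity applies to \<open>g - h\<close> and to
  \<open>h - g\<close>.\<close>

lemma laplace_unique:
  fixes g h :: "real \<Rightarrow> real" and F :: "real \<Rightarrow> real"
  assumes "\<And>s. 0 < s \<Longrightarrow> has_bochner_integral halfline (\<lambda>t. exp (- (s * t)) * g t) (F s)"
    and "\<And>s. 0 < s \<Longrightarrow> has_bochner_integral halfline (\<lambda>t. exp (- (s * t)) * h t) (F s)"
    and "continuous_on {0<..} g" "continuous_on {0<..} h" and t: "0 < t"
  shows "g t = h t"
proof -
  have z: "alternating_derivs (\<lambda>_. 0)"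
    unfolding alternating_derivs_def by (intro exI[of _ "\<lambda>_ _. 0"]) auto
  have "0 \<le> u t - v t" if
     "\<And>s. 0 < s \<Longrightarrow> has_bochner_integral halfline (\<lambda>t. exp (- (s * t)) * u t) (F s)"
     "\<And>s. 0 < s \<Longrightarrow> has_bochner_integral halfline (\<lambda>t. exp (- (s * t)) * v t) (F s)"
     "continuous_on {0<..} u" "continuous_on {0<..} v" for u v
  proof (rule laplace_alternating_imp_nonneg[OF _ z _ t])
    show "has_bochner_integral halfline (\<lambda>t. exp (- (s * t)) * (u t - v t)) 0" if "0 < s" for s
      using has_bochner_integral_diff[OF \<open>\<And>s. 0 < s \<Longrightarrow> has_bochner_integral halfline (\<lambda>t. exp (- (s * t)) * u t) (F s)\<close>[OF that]
        \<open>\<And>s. 0 < s \<Longrightarrow> has_bochner_integral halfline (\<lambda>t. exp (- (s * t)) * v t) (F s)\<close>[OF that]]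
      by (simp add: right_diff_distrib)
  qed (intro continuous_intros that)
  from this[of g h] this[of h g] assms show ?thesis by force
qed

section \<open>The Stieltjes transform of the kernel\<close>

lemma has_contour_integral_linepath_horizontal_iff:
  fixes f :: "complex \<Rightarrow> complex" and a b v :: real
  assumes "a < b"
  shows "(f has_contour_integral I) (linepath (Complex a v) (Complex b v)) \<longleftrightarrow>
           ((\<lambda>u. f (Complex u v)) has_integral I) {a..b}"
proof -
  have "linepath (Complex a v) (Complex b v) u = linepath (of_real a) (of_real b) u + Complex 0 v"
    "Complex b v - Complex a v = of_real b - of_real a" for u
    by (auto simp: linepath_def complex_eq_iff algebra_simps)
  hence "(f has_contour_integral I) (linepath (Complex a v) (Complex b v)) \<longleftrightarrow>
        ((\<lambda>z. f (z + Complex 0 v)) has_contour_integral I) (linepath (of_real a) (of_real b))"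
    by (simp add: has_contour_integral_linepath)
  also have "\<dots> \<longleftrightarrow> ((\<lambda>u. f (of_real u + Complex 0 v)) has_integral I) {a..b}"
    using assms by (subst has_contour_integral_linepath_Reals_iff) auto
  also have "(\<lambda>u. f (of_real u + Complex 0 v)) = (\<lambda>u. f (Complex u v))"
    by (simp add: complex_eq_iff fun_eq_iff)
      (metis Complex_eq complex_of_real_def add.commute add_0 complex_add)
  finally show ?thesis .
qed

text \<open>The substitution \<open>p = q powr (1 / \<nu>)\<close> turns the stretched exponential
  into a Gamma integrand with parameter \<open>(1 - b) / \<nu>\<close>, positive because
  \<open>b < 1\<close>.\<close>

lemma powr_exp_powr_neg_integrable:
  fixes y \<nu> b :: real
  assumes "0 < \<nu>" "b < 1" "0 < y"
  shows "integrable halfline (\<lambda>p. p powr (- b) * exp (- (y * p powr \<nu>)))"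
proof -
  let ?f = "\<lambda>p. p powr (- b) * exp (- (y * p powr \<nu>)) :: real"
  let ?g = "\<lambda>q. q powr (1 / \<nu>) :: real"
  let ?h = "\<lambda>q. 1 / \<nu> * q powr (1 / \<nu> - 1) :: real"
  define z where "z = (1 - b) / \<nu>"
  have z: "0 < z" using assms by (simp add: z_def)
  have "integrable halfline (\<lambda>q. (1 / \<nu>) * (q powr (z - 1) * exp (- (y * q))))"
    using powr_exp_integral_halfline[OF z assms(3)]
    by (intro integrable_mult_right) (simp add: has_bochner_integral_iff)
  hence "(\<lambda>q. (1 / \<nu>) * (q powr (z - 1) * exp (- (y * q)))) absolutely_integrable_on {0<..}"
    by (simp add: integrable_halfline_iff set_integrable_def integrable_completion)
  also have "?this \<longleftrightarrow> (\<lambda>q. \<bar>?h q\<bar> *\<^sub>R ?f (?g q)) absolutely_integrable_on {0<..}"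
  proof (rule set_integrable_cong)
    fix q :: real assume "q \<in> {0<..}"
    hence q: "0 < q" by simp
    have "q powr (z - 1) = q powr (1 / \<nu> - 1) * q powr (- b / \<nu>)"
      by (simp add: z_def powr_add[symmetric] diff_divide_distrib algebra_simps)
    thus "(1 / \<nu>) * (q powr (z - 1) * exp (- (y * q))) = \<bar>?h q\<bar> *\<^sub>R ?f (?g q)"
      using q assms by (simp add: powr_powr)
  qed auto
  also have "\<dots> \<longleftrightarrow> ?f absolutely_integrable_on ?g ` {0<..}"
  proof (rule absolutely_integrable_change_of_variables_real[symmetric])
    show "(?g has_real_derivative ?h q) (at q within {0<..})" if "q \<in> {0<..}" for q
      using that assms by (auto intro!: derivative_eq_intros)
    show "inj_on ?g {0<..}"
      using assms by (intro inj_on_inverseI[of _ "\<lambda>p. p powr \<nu>"]) (auto simp: powr_powr)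
  qed auto
  also have "?g ` {0<..} = {0<..}"
  proof (intro equalityI subsetI)
    fix p :: real assume "p \<in> {0<..}"
    thus "p \<in> ?g ` {0<..}" using assms by (intro image_eqI[of _ _ "p powr \<nu>"]) (auto simp: powr_powr)
  qed auto
  finally have "integrable lebesgue (\<lambda>p. indicator {0<..} p *\<^sub>R ?f p)"
    by (simp add: set_integrable_def)
  hence "integrable lborel (\<lambda>p. indicator {0<..} p *\<^sub>R ?f p)"
    by (subst (asm) integrable_completion) auto
  thus ?thesis by (simp add: integrable_halfline_iff)
qed

text \<open>The imaginary part of s^(-b) exp (- x s^\<nu>), continued from the positive axis to the
  lower side of the negative axis, that is, to modulus \<open>p\<close> and argument - pi.\<close>

definition stable_kernel :: "real \<Rightarrow> real \<Rightarrow> real \<Rightarrow> real \<Rightarrow> real" where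
  "stable_kernel \<nu> b x p = p powr (- b) * exp (- (x * p powr \<nu> * cos (pi * \<nu>)))
     * sin (pi * b + x * p powr \<nu> * sin (pi * \<nu>))"

lemma stable_kernel_measurable [measurable]: "stable_kernel \<nu> b x \<in> borel_measurable borel"
  unfolding stable_kernel_def by measurable

lemma stable_kernel_le:
  "\<bar>stable_kernel \<nu> b x p\<bar> \<le> p powr (- b) * exp (- (x * cos (pi * \<nu>) * p powr \<nu>))"
  unfolding stable_kernel_def abs_mult
  by (intro order_trans[OF mult_left_mono[OF abs_sin_le_one]]) (auto simp: mult_ac)

lemma cos_pi_pos:
  fixes \<nu> :: real
  assumes "0 < \<nu>" "\<nu> < 1/2"
  shows "0 < cos (pi * \<nu>)"
proof (rule cos_gt_zero)
  have "pi * \<nu> < pi * (1/2)" using assms by (intro mult_strict_left_mono) auto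
  thus "pi * \<nu> < pi / 2" by simp
qed (use assms in simp)

text \<open>Since \<open>\<nu> < 1/2\<close> makes the cosine positive, the kernel is integrable
  without the help of \<open>exp (- (t * p))\<close>, which later gives bounds uniform in
  \<open>t\<close>.\<close>

lemma stable_kernel_integrable:
  assumes "0 < \<nu>" "\<nu> < 1/2" "b < 1" "0 < x"
  shows "integrable halfline (stable_kernel \<nu> b x)"
proof (rule Bochner_Integration.integrable_bound)
  show "integrable halfline (\<lambda>p. p powr (- b) * exp (- (x * cos (pi * \<nu>) * p powr \<nu>)))"
    using assms cos_pi_pos[of \<nu>] by (intro powr_exp_powr_neg_integrable) auto
  show "AE p in halfline. norm (stable_kernel \<nu> b x p)
      \<le> norm (p powr (- b) * exp (- (x * cos (pi * \<nu>) * p powr \<nu>)))"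
    using stable_kernel_le by (intro AE_halfline) simp
qed measurable

text \<open>The truncation points are exponentials so that the logarithmic coordinate runs over a
  symmetric interval, the width of a rectangle.\<close>

lemma integral_Icc_tendsto_halfline:
  fixes f :: "real \<Rightarrow> real"
  assumes "integrable halfline f" and [measurable]: "f \<in> borel_measurable borel"
  shows "(\<lambda>n. integral {exp (- real n)..exp (real n)} f) \<longlonglongrightarrow> integral\<^sup>L halfline f"
proof -
  have i: "integrable lborel (\<lambda>x. indicator {0<..} x *\<^sub>R f x)"
    using assms(1) by (simp add: integrable_halfline_iff)
  have eq: "integral {exp (- real n)..exp (real n)} f =
      integral\<^sup>L lborel (\<lambda>x. indicator {exp (- real n)..exp (real n)} x *\<^sub>R f x)" for n
  proof -
    have "set_integrable lborel {exp (- real n)..exp (real n)} f"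
    proof (rule set_integrable_subset)
      show "set_integrable lborel {0<..} f" using i by (simp add: set_integrable_def)
    qed (auto intro: less_le_trans[OF exp_gt_zero])
    from set_borel_integral_eq_integral(2)[OF this] show ?thesis
      by (simp add: set_lebesgue_integral_def)
  qed
  show ?thesis unfolding eq integral_halfline_eq
  proof (rule integral_dominated_convergence[where w = "\<lambda>x. norm (indicator {0<..} x *\<^sub>R f x)"])
    show "AE x in lborel. (\<lambda>n. indicator {exp (- real n)..exp (real n)} x *\<^sub>R f x) \<longlonglongrightarrow> indicator {0<..} x *\<^sub>R f x"
    proof (rule AE_I2)
      fix x :: real
      have "eventually (\<lambda>n. indicator {exp (- real n)..exp (real n)} x = (indicator {0<..} x :: real)) sequentially"
      proof (cases "0 < x")
        case True
        obtain N :: nat where N: "\<bar>ln x\<bar> \<le> real N" using real_arch_simple by blast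
        have "exp (- real n) \<le> x \<and> x \<le> exp (real n)" if "N \<le> n" for n
        proof -
          have "- real n \<le> ln x" "ln x \<le> real n" using N that by linarith+
          hence "exp (- real n) \<le> exp (ln x)" "exp (ln x) \<le> exp (real n)" by (simp_all only: exp_le_cancel_iff)
          thus ?thesis using True by simp
        qed
        thus ?thesis using True by (auto simp: eventually_sequentially indicator_def intro!: exI[of _ N])
      next
        case False
        hence "\<not> exp (- real n) \<le> x" for n by (meson exp_gt_zero less_le_trans)
        thus ?thesis using False by (auto simp: indicator_def)
      qed
      thus "(\<lambda>n. indicator {exp (- real n)..exp (real n)} x *\<^sub>R f x) \<longlonglongrightarrow> indicator {0<..} x *\<^sub>R f x"
        by (intro tendsto_eventually) (auto elim!: eventually_mono)
    qed
    show "AE x in lborel. norm (indicator {exp (- real n)..exp (real n)} x *\<^sub>R f x)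
        \<le> norm (indicator {0<..} x *\<^sub>R f x)" for n
      by (rule AE_I2) (auto simp: indicator_def intro: less_le_trans[OF exp_gt_zero])
    show "integrable lborel (\<lambda>x. norm (indicator {0<..} x *\<^sub>R f x))" using i by (rule integrable_norm)
  qed measurable
qed

section \<open>The residue computation in the logarithmic coordinate\<close>

context
  fixes \<nu> b x s :: real
  assumes \<nu>: "0 < \<nu>" "\<nu> < 1/2" and b: "0 \<le> b" "b < 1" and x: "0 < x" and s: "0 < s"
begin

text \<open>The substitution \<open>p = exp w\<close> removes the branch cut: the integrand becomes meromorphic in the strip
  \<open>\<bar>Im w\<bar> < 2 * pi\<close>, with its only pole at \<open>ln s\<close>, and the kernel is its imaginary part on \<open>Im w = pi\<close>.\<close>

definition strip_num :: "complex \<Rightarrow> complex" where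
  "strip_num w = exp (of_real (1 - b) * w - of_real x * exp (of_real \<nu> * w))"

definition strip_fun :: "complex \<Rightarrow> complex" where
  "strip_fun w = strip_num w / (of_real s - exp w)"

lemma exp_eq_in_strip:
  assumes "exp w = of_real s" "\<bar>Im w\<bar> < 2 * pi"
  shows "w = of_real (ln s)"
proof -
  have "exp w = exp (of_real (ln s))" using s assms(1) by (simp add: exp_of_real)
  then obtain n :: int where n: "w = of_real (ln s) + of_int (2 * n) * pi * \<i>"
    by (auto simp: exp_eq)
  hence "\<bar>of_int n\<bar> * (2 * pi) < 1 * (2 * pi)" using assms(2) by (simp add: abs_mult)
  hence "\<bar>real_of_int n\<bar> < 1" using mult_less_cancel_right_pos[of "2 * pi"] by simp
  hence "n = 0" by linarith
  with n show ?thesis by simp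
qed

lemma strip_fun_holomorphic: "strip_fun holomorphic_on {w. \<bar>Im w\<bar> < 2 * pi} - {of_real (ln s)}"
  unfolding strip_fun_def strip_num_def using exp_eq_in_strip
  by (intro holomorphic_intros) auto

lemma strip_fun_residue: "residue strip_fun (of_real (ln s)) = - of_real (s powr (- b) * exp (- (x * s powr \<nu>)))"
proof -
  have "residue (\<lambda>w. strip_num w / (of_real s - exp w)) (of_real (ln s)) = strip_num (of_real (ln s)) / (- of_real s)"
  proof (rule residue_simple_pole_deriv)
    show "strip_num holomorphic_on UNIV" unfolding strip_num_def by (intro holomorphic_intros)
    show "(\<lambda>w. of_real s - exp w) holomorphic_on UNIV" by (intro holomorphic_intros)
    show "((\<lambda>w. of_real s - exp w) has_field_derivative - of_real s) (at (of_real (ln s)))"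
      using s by (auto intro!: derivative_eq_intros simp: exp_of_real)
  qed (use s in \<open>auto simp: strip_num_def exp_of_real\<close>)
  also have "strip_num (of_real (ln s)) = of_real (s powr (1 - b) * exp (- (x * s powr \<nu>)))"
    using s by (simp add: strip_num_def powr_def exp_of_real[symmetric] exp_diff exp_minus divide_inverse mult_ac)
  also have "\<dots> / (- of_real s) = - of_real (s powr (- b) * exp (- (x * s powr \<nu>)))"
    using s by (simp add: powr_diff powr_minus field_simps)
  finally show ?thesis by (simp add: strip_fun_def[abs_def])
qed

text \<open>Cosine decreases on the interval from 0 to pi, so within the closed strip the decay is
  weakest on the edges, where the cosine is still \<open>cos (pi * \<nu>)\<close>.\<close>

lemma strip_num_norm_le:
  assumes "\<bar>Im w\<bar> \<le> pi"
  shows "norm (strip_num w) \<le> exp ((1 - b) * Re w - x * cos (pi * \<nu>) * exp (\<nu> * Re w))"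
proof -
  have "cos (pi * \<nu>) \<le> cos \<bar>\<nu> * Im w\<bar>"
    using assms \<nu> by (intro cos_monotone_0_pi_le) (auto simp: abs_mult mult.commute[of pi] intro!: mult_left_mono order_trans[of _ "1 * pi"] mult_right_mono)
  hence "cos (pi * \<nu>) \<le> cos (\<nu> * Im w)" by simp
  hence "x * (exp (\<nu> * Re w) * cos (pi * \<nu>)) \<le> x * (exp (\<nu> * Re w) * cos (\<nu> * Im w))"
    using x by (intro mult_left_mono) auto
  thus ?thesis by (simp add: strip_num_def Re_exp mult_ac)
qed

text \<open>On this line \<open>exp w = - exp u\<close>, so the denominator is the real number
  \<open>s + exp u\<close>; the extra factor \<open>exp u\<close> is the Jacobian of
  \<open>p = exp u\<close>.\<close>

lemma strip_fun_top:
  "Im (strip_fun (Complex u pi)) = exp u * (stable_kernel \<nu> b x (exp u) / (s + exp u))"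
  (is "?l = ?r")
proof -
  have e: "exp (Complex u pi) = - of_real (exp u)"
    by (simp add: exp_eq_polar complex_eq_iff)
  have "strip_fun (Complex u pi) = strip_num (Complex u pi) / of_real (s + exp u)"
    by (simp add: strip_fun_def e)
  hence "?l = Im (strip_num (Complex u pi)) / (s + exp u)"
    by (simp only: Im_divide_of_real)
  also have "Im (strip_num (Complex u pi)) =
      exp ((1 - b) * u - x * (exp (\<nu> * u) * cos (\<nu> * pi))) * sin ((1 - b) * pi - x * (exp (\<nu> * u) * sin (\<nu> * pi)))"
    by (simp add: strip_num_def Im_exp Re_exp)
  also have "(1 - b) * pi - x * (exp (\<nu> * u) * sin (\<nu> * pi)) = pi - (pi * b + x * exp (\<nu> * u) * sin (pi * \<nu>))"
    by (simp add: algebra_simps)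
  also have "sin \<dots> = sin (pi * b + x * exp (\<nu> * u) * sin (pi * \<nu>))" by (rule sin_pi_minus)
  also have "exp ((1 - b) * u - x * (exp (\<nu> * u) * cos (\<nu> * pi))) =
     exp u * (exp (- b * u) * exp (- (x * exp (\<nu> * u) * cos (pi * \<nu>))))"
    by (simp add: exp_add[symmetric] algebra_simps)
  finally show ?thesis by (simp add: stable_kernel_def powr_def mult_ac)
qed

text \<open>This makes the integral over the lower edge the conjugate of that over the upper
  one.\<close>

lemma strip_fun_cnj: "strip_fun (cnj w) = cnj (strip_fun w)"
  by (simp add: strip_fun_def strip_num_def exp_cnj)

text \<open>The right edge is suppressed by a doubly exponential factor, the left edge only by
  \<open>1 - b > 0\<close>.\<close>

lemma strip_fun_vertical_bounds:
  assumes R: "\<bar>ln s\<bar> < R" and v: "\<bar>v\<bar> \<le> pi"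
  shows "norm (strip_fun (Complex R v)) \<le> exp (- (x * cos (pi * \<nu>) * exp (\<nu> * R))) * (exp R / (exp R - s))"
    and "norm (strip_fun (Complex (- R) v)) \<le> exp (- ((1 - b) * R)) * (1 / (s - exp (- R)))"
proof -
  have "exp (ln s) < exp R" using R unfolding exp_less_cancel_iff by linarith
  hence sR: "s < exp R" using s by simp
  have "exp (- R) < exp (ln s)" using R unfolding exp_less_cancel_iff by linarith
  hence sR': "exp (- R) < s" using s by simp
  have R0: "0 < R" using R by linarith
  have "exp R - s \<le> norm (of_real s - exp (Complex R v))"
    using norm_triangle_ineq3[of "of_real s" "exp (Complex R v)"] s by simp
  hence "norm (strip_fun (Complex R v)) \<le> norm (strip_num (Complex R v)) / (exp R - s)"
    unfolding strip_fun_def norm_divide using sR by (intro divide_left_mono mult_pos_pos) auto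
  also have "\<dots> \<le> exp ((1 - b) * R - x * cos (pi * \<nu>) * exp (\<nu> * R)) / (exp R - s)"
    using strip_num_norm_le[of "Complex R v"] v sR by (intro divide_right_mono) auto
  also have "\<dots> \<le> exp (R - x * cos (pi * \<nu>) * exp (\<nu> * R)) / (exp R - s)"
    using sR R0 b by (intro divide_right_mono) (auto simp: algebra_simps)
  finally show "norm (strip_fun (Complex R v)) \<le> exp (- (x * cos (pi * \<nu>) * exp (\<nu> * R))) * (exp R / (exp R - s))"
    by (simp add: exp_diff exp_minus field_simps)
  have "s - exp (- R) \<le> norm (of_real s - exp (Complex (- R) v))"
    using norm_triangle_ineq2[of "of_real s" "exp (Complex (- R) v)"] s by simp
  hence "norm (strip_fun (Complex (- R) v)) \<le> norm (strip_num (Complex (- R) v)) / (s - exp (- R))"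
    unfolding strip_fun_def norm_divide using sR' by (intro divide_left_mono mult_pos_pos) auto
  also have "\<dots> \<le> exp (- ((1 - b) * R) - x * cos (pi * \<nu>) * exp (\<nu> * (- R))) / (s - exp (- R))"
    using strip_num_norm_le[of "Complex (- R) v"] v sR' by (intro divide_right_mono) (auto simp: algebra_simps)
  also have "\<dots> \<le> exp (- ((1 - b) * R)) / (s - exp (- R))"
    using sR' x cos_pi_pos[OF \<nu>] by (intro divide_right_mono) auto
  finally show "norm (strip_fun (Complex (- R) v)) \<le> exp (- ((1 - b) * R)) * (1 / (s - exp (- R)))"
    by simp
qed

text \<open>Residue theorem on the rectangle of half-width \<open>R\<close> and half-height pi. By
  conjugation symmetry the horizontal edges contribute \<open>cnj J - J\<close>, in which only the
  imaginary part of \<open>J\<close> survives; the bound is what the vertical edges can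
  contribute.\<close>

lemma strip_fun_rectangle:
  assumes R: "\<bar>ln s\<bar> < R"
  shows "\<bar>integral {-R..R} (\<lambda>u. Im (strip_fun (Complex u pi))) - pi * (s powr (- b) * exp (- (x * s powr \<nu>)))\<bar>
     \<le> pi * (exp (- (x * cos (pi * \<nu>) * exp (\<nu> * R))) * (exp R / (exp R - s))
              + exp (- ((1 - b) * R)) * (1 / (s - exp (- R))))"
proof -
  let ?S = "{w. \<bar>Im w\<bar> < 2 * pi}"
  let ?p = "complex_of_real (ln s)"
  let ?c = "s powr (- b) * exp (- (x * s powr \<nu>))"
  define B1 B2 where "B1 = exp (- (x * cos (pi * \<nu>) * exp (\<nu> * R))) * (exp R / (exp R - s))"
    and "B2 = exp (- ((1 - b) * R)) * (1 / (s - exp (- R)))"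
  define a1 a2 a3 a4 where "a1 = Complex (-R) (-pi)" and "a2 = Complex R (-pi)"
    and "a3 = Complex R pi" and "a4 = Complex (-R) pi"
  note a_defs = a1_def a2_def a3_def a4_def
  have R0: "0 < R" using R by linarith
  have S: "?S = {w. Im w < 2 * pi} \<inter> {w. Im w > - 2 * pi}" by auto
  have rect: "rectpath a1 a3 = linepath a1 a2 +++ linepath a2 a3 +++ linepath a3 a4 +++ linepath a4 a1"
    by (simp add: rectpath_def a_defs Let_def)
  have image: "path_image (rectpath a1 a3) = cbox a1 a3 - box a1 a3"
    by (rule path_image_rectpath_cbox_minus_box) (use R0 in \<open>auto simp: a_defs\<close>)
  have pbox: "?p \<in> box a1 a3" using R by (auto simp: in_box_complex_iff a_defs)
  have cboxS: "cbox a1 a3 \<subseteq> ?S"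
  proof
    fix w assume "w \<in> cbox a1 a3"
    hence "\<bar>Im w\<bar> \<le> pi" by (auto simp: in_cbox_complex_iff a_defs)
    also have "pi < 2 * pi" by simp
    finally show "w \<in> ?S" by simp
  qed
  have sub: "path_image (rectpath a1 a3) \<subseteq> ?S - {?p}"
    using image pbox cboxS by auto
  have "contour_integral (rectpath a1 a3) strip_fun = 2 * pi * \<i> *
          (\<Sum>p\<in>{?p}. winding_number (rectpath a1 a3) p * residue strip_fun p)"
  proof (rule Residue_theorem[where S = ?S])
    show "open ?S" unfolding S by (intro open_Int open_halfspace_Im_lt open_halfspace_Im_gt)
    show "connected ?S" unfolding S
      by (intro convex_connected convex_Int convex_halfspace_Im_lt convex_halfspace_Im_gt)
    show "strip_fun holomorphic_on ?S - {?p}" by (rule strip_fun_holomorphic)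
    show "\<forall>z. z \<notin> ?S \<longrightarrow> winding_number (rectpath a1 a3) z = 0"
    proof (intro allI impI)
      fix z assume "z \<notin> ?S"
      hence "z \<notin> cbox a1 a3" using cboxS by blast
      thus "winding_number (rectpath a1 a3) z = 0"
        using R0 by (intro winding_number_rectpath_outside) (auto simp: a_defs)
    qed
  qed (use sub in auto)
  hence total: "contour_integral (rectpath a1 a3) strip_fun = - (2 * pi * \<i> * of_real ?c)"
    using winding_number_rectpath[OF pbox] strip_fun_residue by simp
  have cont: "continuous_on (?S - {?p}) strip_fun"
    using strip_fun_holomorphic by (rule holomorphic_on_imp_continuous_on)
  have seg: "closed_segment a1 a2 \<subseteq> ?S - {?p}" "closed_segment a2 a3 \<subseteq> ?S - {?p}"
      "closed_segment a3 a4 \<subseteq> ?S - {?p}" "closed_segment a4 a1 \<subseteq> ?S - {?p}"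
    using sub unfolding rect by (auto simp: path_image_join a_defs)
  have int: "strip_fun contour_integrable_on linepath a1 a2" "strip_fun contour_integrable_on linepath a2 a3"
     "strip_fun contour_integrable_on linepath a3 a4" "strip_fun contour_integrable_on linepath a4 a1"
    by (intro contour_integrable_continuous_linepath continuous_on_subset[OF cont] seg)+
  have split: "contour_integral (rectpath a1 a3) strip_fun =
      contour_integral (linepath a1 a2) strip_fun + contour_integral (linepath a2 a3) strip_fun
       + contour_integral (linepath a3 a4) strip_fun + contour_integral (linepath a4 a1) strip_fun"
    unfolding rect using int by simp
  \<comment> \<open>\<open>J\<close> runs from left to right, against the orientation of the
    rectangle, hence the sign in \<open>J34\<close>.\<close>
  define J where "J = contour_integral (linepath a4 a3) strip_fun"
  have "strip_fun contour_integrable_on linepath a4 a3"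
    using int(3) contour_integrable_reversepath[of "linepath a3 a4"] by simp
  hence "(strip_fun has_contour_integral J) (linepath a4 a3)"
    unfolding J_def by (rule has_contour_integral_integral)
  hence J: "((\<lambda>u. strip_fun (Complex u pi)) has_integral J) {-R..R}"
    unfolding a_defs using R0 by (subst (asm) has_contour_integral_linepath_horizontal_iff) auto
  have J34: "contour_integral (linepath a3 a4) strip_fun = - J"
    unfolding J_def using contour_integral_reversepath[of "linepath a4 a3" strip_fun] by simp
  have "((\<lambda>u. cnj (strip_fun (Complex u pi))) has_integral cnj J) {-R..R}"
    using has_integral_linear[OF J bounded_linear_cnj] by (simp add: o_def)
  moreover have "cnj (strip_fun (Complex u pi)) = strip_fun (Complex u (-pi))" for u
    by (metis complex_cnj strip_fun_cnj)
  ultimately have "((\<lambda>u. strip_fun (Complex u (-pi))) has_integral cnj J) {-R..R}" by simp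
  hence "(strip_fun has_contour_integral cnj J) (linepath a1 a2)"
    unfolding a_defs using R0 by (subst has_contour_integral_linepath_horizontal_iff) auto
  hence J12: "contour_integral (linepath a1 a2) strip_fun = cnj J" by (rule contour_integral_unique)
  have R12: "0 \<le> B1" "0 \<le> B2"
  proof -
    \<comment> \<open>The bounds dominate a norm at height 0, hence are nonnegative.\<close>
    have "norm (strip_fun (Complex R 0)) \<le> B1" "norm (strip_fun (Complex (- R) 0)) \<le> B2"
      unfolding B1_def B2_def using strip_fun_vertical_bounds[OF R, of 0] by auto
    thus "0 \<le> B1" "0 \<le> B2" by (meson norm_ge_zero order_trans)+
  qed
  have V1: "norm (contour_integral (linepath a2 a3) strip_fun) \<le> B1 * norm (a3 - a2)"
  proof (rule contour_integral_bound_linepath[OF int(2) R12(1)])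
    fix w assume "w \<in> closed_segment a2 a3"
    hence "Re w = R" "\<bar>Im w\<bar> \<le> pi" by (auto simp: a_defs closed_segment_same_Re closed_segment_eq_real_ivl)
    thus "norm (strip_fun w) \<le> B1"
      using strip_fun_vertical_bounds(1)[OF R, of "Im w"] by (cases w) (simp add: B1_def)
  qed
  have V2: "norm (contour_integral (linepath a4 a1) strip_fun) \<le> B2 * norm (a1 - a4)"
  proof (rule contour_integral_bound_linepath[OF int(4) R12(2)])
    fix w assume "w \<in> closed_segment a4 a1"
    hence "Re w = - R" "\<bar>Im w\<bar> \<le> pi" using pi_gt_zero
      by (auto simp: a_defs closed_segment_same_Re closed_segment_eq_real_ivl split: if_splits)
    thus "norm (strip_fun w) \<le> B2"
      using strip_fun_vertical_bounds(2)[OF R, of "Im w"] by (cases w) (simp add: B2_def)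
  qed
  let ?V = "contour_integral (linepath a2 a3) strip_fun + contour_integral (linepath a4 a1) strip_fun"
  have "norm (a3 - a2) = 2 * pi" "norm (a1 - a4) = 2 * pi"
    by (auto simp: a_defs norm_complex_def real_sqrt_mult)
  hence V: "norm ?V \<le> B1 * (2 * pi) + B2 * (2 * pi)"
    using norm_triangle_mono[OF V1 V2] by simp
  have "cnj J - J + ?V = - (2 * pi * \<i> * of_real ?c)"
    unfolding total[symmetric] split J12 J34 by simp
  hence "Im (cnj J - J + ?V) = Im (- (2 * pi * \<i> * of_real ?c))" by (rule arg_cong)
  hence "2 * (Im J - pi * ?c) = Im ?V" by simp
  moreover have "\<bar>Im ?V\<bar> \<le> B1 * (2 * pi) + B2 * (2 * pi)" using abs_Im_le_cmod V by (rule order_trans)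
  moreover have "\<bar>a - c\<bar> \<le> B" if "2 * (a - c) = v" "\<bar>v\<bar> \<le> 2 * B" for a c v B :: real
    using that by (auto simp: abs_le_iff)
  ultimately have "\<bar>Im J - pi * ?c\<bar> \<le> pi * (B1 + B2)" by (simp add: algebra_simps)
  moreover have "((\<lambda>u. Im (strip_fun (Complex u pi))) has_integral Im J) {-R..R}"
    using has_integral_linear[OF J bounded_linear_Im] by (simp add: o_def)
  ultimately show ?thesis unfolding B1_def B2_def by (simp only: integral_unique)
qed

text \<open>Under \<open>p = exp u\<close> a truncated integral is the imaginary part of the upper
  edge, whose error tends to 0; integrability identifies the limit of the truncations with the
  integral.\<close>

lemma stieltjes_stable_kernel:
  "has_bochner_integral halfline (\<lambda>p. stable_kernel \<nu> b x p / (s + p)) (pi * (s powr (- b) * exp (- (x * s powr \<nu>))))"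
proof -
  let ?f = "\<lambda>p. stable_kernel \<nu> b x p / (s + p)"
  let ?c = "s powr (- b) * exp (- (x * s powr \<nu>))"
  have i: "integrable halfline ?f"
  proof (rule Bochner_Integration.integrable_bound)
    show "integrable halfline (\<lambda>p. 1 / s * stable_kernel \<nu> b x p)"
      using stable_kernel_integrable \<nu> b x by (intro integrable_mult_right) auto
    show "AE p in halfline. norm (?f p) \<le> norm (1 / s * stable_kernel \<nu> b x p)"
      using s by (intro AE_halfline) (auto simp: abs_mult field_simps intro!: mult_right_mono)
  qed measurable
  have sub: "integral {exp (- R)..exp R} ?f = integral {-R..R} (\<lambda>u. Im (strip_fun (Complex u pi)))"
    if "0 \<le> R" for R
  proof -
    have "((\<lambda>u. exp u *\<^sub>R ?f (exp u)) has_integral integral {exp (- R)..exp R} ?f) {-R..R}"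
    proof (rule has_integral_substitution[where c = "exp (- R)" and d = "exp R"])
      show "continuous_on {exp (- R)..exp R} ?f"
      proof -
        have "p \<noteq> 0 \<and> s + p \<noteq> 0" if "p \<in> {exp (- R)..exp R}" for p
        proof -
          have "0 < p" using that less_le_trans[OF exp_gt_zero[of "- R"]] by simp
          thus ?thesis using s by simp
        qed
        thus ?thesis unfolding stable_kernel_def by (intro continuous_intros) auto
      qed
      show "(exp has_real_derivative exp u) (at u within {-R..R})" for u
        by (auto intro!: derivative_eq_intros)
    qed (use that in auto)
    thus ?thesis by (simp add: integral_unique strip_fun_top)
  qed
  have "(\<lambda>n. integral {exp (- real n)..exp (real n)} ?f) \<longlonglongrightarrow> pi * ?c"
  proof (rule Lim_null_comparison[THEN LIM_zero_cancel])
    let ?B = "\<lambda>R. pi * (exp (- (x * cos (pi * \<nu>) * exp (\<nu> * R))) * (exp R / (exp R - s))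
              + exp (- ((1 - b) * R)) * (1 / (s - exp (- R))))"
    have "eventually (\<lambda>n. \<bar>ln s\<bar> < real n) sequentially"
      using filterlim_real_sequentially by (auto simp: filterlim_at_top_dense)
    thus "eventually (\<lambda>n. norm (integral {exp (- real n)..exp (real n)} ?f - pi * ?c) \<le> ?B (real n)) sequentially"
      by eventually_elim (use strip_fun_rectangle in \<open>simp add: sub\<close>)
    define c d where "c = x * cos (pi * \<nu>)" and "d = 1 - b"
    have "0 < c" "0 < d" using cos_pi_pos[OF \<nu>] x b by (auto simp: c_def d_def)
    hence "((\<lambda>R. pi * (exp (- (c * exp (\<nu> * R))) * (exp R / (exp R - s))
              + exp (- (d * R)) * (1 / (s - exp (- R))))) \<longlongrightarrow> 0) at_top"
      using s \<nu> by real_asymp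
    hence "(?B \<longlongrightarrow> 0) at_top" by (simp only: c_def d_def)
    thus "(\<lambda>n. ?B (real n)) \<longlonglongrightarrow> 0" using filterlim_real_sequentially by (rule filterlim_compose)
  qed
  moreover have "(\<lambda>n. integral {exp (- real n)..exp (real n)} ?f) \<longlonglongrightarrow> integral\<^sup>L halfline ?f"
    by (rule integral_Icc_tendsto_halfline[OF i]) measurable
  ultimately have "integral\<^sup>L halfline ?f = pi * ?c" by (rule LIMSEQ_unique[rotated])
  with i show ?thesis by (simp add: has_bochner_integral_iff)
qed

end

section \<open>The Wright function\<close>

lemma Wright_powser: "Wright z a b = (\<Sum>n. (1 / (fact n * Gamma (real n * a + b))) * z ^ n)"
  by (simp add: Wright_def)

text \<open>In reciprocal form the recurrence of Gamma has no exceptions: at the poles both sides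
  are 0.\<close>

lemma rGamma_shift: "1 / Gamma y = y / Gamma (y + 1 :: real)"
  using rGamma_plus1[of y] by (simp add: Gamma_def divide_inverse)

text \<open>Reflection bounds the reciprocal Gamma values by \<open>Gamma (1 - y)\<close>, whose
  argument grows only like \<open>\<nu> * n\<close> and is beaten by the factorial.\<close>

lemma summable_Wright_less_1:
  fixes \<nu> b z :: real
  assumes \<nu>: "0 < \<nu>" "\<nu> < 1" and b: "b < 1"
  shows "summable (\<lambda>n. (1 / (fact n * Gamma (real n * (- \<nu>) + b))) * z ^ n)"
proof (rule summable_comparison_test')
  show "summable (\<lambda>n. \<bar>z\<bar> ^ n / fact n * (Gamma (\<nu> * real n + (1 - b)) / 1 powr (\<nu> * real n + (1 - b))))"
    using assms by (intro summable_Gamma_over_fact) auto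
  fix n
  let ?y = "real n * (- \<nu>) + b"
  have y: "?y < 1" using assms by (smt (verit) mult_nonneg_nonneg of_nat_0_le_iff mult_minus_right)
  have G: "0 < Gamma (1 - ?y)" using y by (intro Gamma_real_pos) auto
  have "\<bar>1 / Gamma ?y\<bar> = Gamma (1 - ?y) * (\<bar>sin (pi * ?y)\<bar> / pi)"
    unfolding rGamma_reflection[OF y] using G by (simp add: abs_mult)
  also have "\<dots> \<le> Gamma (1 - ?y) * 1"
    using G pi_ge_two
    by (intro mult_left_mono order_trans[OF divide_right_mono[OF abs_sin_le_one]]) auto
  finally have "\<bar>1 / Gamma ?y\<bar> \<le> Gamma (1 - ?y)" by simp
  hence "\<bar>z\<bar> ^ n / fact n * \<bar>1 / Gamma ?y\<bar> \<le> \<bar>z\<bar> ^ n / fact n * Gamma (1 - ?y)"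
    by (intro mult_left_mono) auto
  thus "norm ((1 / (fact n * Gamma ?y)) * z ^ n)
      \<le> \<bar>z\<bar> ^ n / fact n * (Gamma (\<nu> * real n + (1 - b)) / 1 powr (\<nu> * real n + (1 - b)))"
    by (simp add: abs_mult power_abs algebra_simps)
qed

lemma diffs_Wright:
  "diffs (\<lambda>n. 1 / (fact n * Gamma (real n * (- \<nu>) + b))) = (\<lambda>n. 1 / (fact n * Gamma (real n * (- \<nu>) + (b - \<nu>))))"
proof
  fix n
  have e: "real (Suc n) * (- \<nu>) + b = real n * (- \<nu>) + (b - \<nu>)" by (simp add: algebra_simps)
  show "diffs (\<lambda>n. 1 / (fact n * Gamma (real n * (- \<nu>) + b))) n = 1 / (fact n * Gamma (real n * (- \<nu>) + (b - \<nu>)))"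
    unfolding diffs_def e fact_Suc of_nat_mult mult.assoc by (simp del: of_nat_Suc)
qed

text \<open>The reflection bound needs \<open>b < 1\<close>, whereas the temperature has
  \<open>b = 1\<close>. The differentiated series has parameter \<open>b - \<nu> < 1\<close> and
  dominates the original one apart from its first term.\<close>

lemma summable_Wright:
  fixes \<nu> b z :: real
  assumes \<nu>: "0 < \<nu>" "\<nu> < 1" and b: "b \<le> 1"
  shows "summable (\<lambda>n. (1 / (fact n * Gamma (real n * (- \<nu>) + b))) * z ^ n)" (is "summable (\<lambda>n. ?a n * z ^ n)")
proof -
  have "summable (\<lambda>n. \<bar>z\<bar> * \<bar>diffs ?a n * z ^ n\<bar>)"
  proof (intro summable_mult)
    have "summable (\<lambda>n. norm (diffs ?a n * z ^ n))"
      unfolding diffs_Wright using assms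
      by (intro powser_insidea[of _ "\<bar>z\<bar> + 1"] summable_Wright_less_1) auto
    thus "summable (\<lambda>n. \<bar>diffs ?a n * z ^ n\<bar>)" by simp
  qed
  hence "summable (\<lambda>n. ?a (Suc n) * z ^ Suc n)"
  proof (rule summable_comparison_test')
    fix n
    have "\<bar>?a (Suc n) * z ^ Suc n\<bar> \<le> real (Suc n) * \<bar>?a (Suc n) * z ^ Suc n\<bar>"
      using mult_right_mono[of 1 "real (Suc n)" "\<bar>?a (Suc n) * z ^ Suc n\<bar>"]
      by (simp only: abs_ge_zero mult_1 of_nat_le_iff[where 'a=real, of 1, simplified])
    also have "\<dots> = \<bar>z\<bar> * \<bar>diffs ?a n * z ^ n\<bar>"
      unfolding diffs_def power_Suc abs_mult by (simp only: abs_of_nat mult_ac)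
    finally show "norm (?a (Suc n) * z ^ Suc n) \<le> \<bar>z\<bar> * \<bar>diffs ?a n * z ^ n\<bar>" by simp
  qed
  thus ?thesis by (subst (asm) summable_Suc_iff)
qed

lemma has_derivative_Wright [derivative_intros]:
  fixes \<nu> b z :: real
  assumes "0 < \<nu>" "\<nu> < 1" "b \<le> 1"
  shows "((\<lambda>z. Wright z (- \<nu>) b) has_real_derivative Wright z (- \<nu>) (b - \<nu>)) (at z)"
  using termdiffs_strong_converges_everywhere[OF summable_Wright[OF assms], of z]
  unfolding Wright_powser diffs_Wright .

lemma Wright_0_arg: "Wright 0 a b = 1 / Gamma b"
proof -
  have "(\<lambda>n. 0 ^ n / (fact n * Gamma (real n * a + b))) sums (\<Sum>n\<in>{0}. 0 ^ n / (fact n * Gamma (real n * a + b)))"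
    by (rule sums_finite) auto
  thus ?thesis by (simp add: Wright_def sums_iff)
qed

text \<open>This links the density at \<open>b = 0\<close> to the Mainardi function: the recurrence
  of Gamma cancels one factor of the factorial.\<close>

lemma Wright_b_0:
  fixes \<nu> z :: real
  assumes "0 < \<nu>" "\<nu> < 1"
  shows "Wright z (- \<nu>) 0 = - \<nu> * z * Wright z (- \<nu>) (1 - \<nu>)"
proof -
  let ?a = "\<lambda>b n. (1 / (fact n * Gamma (real n * (- \<nu>) + b))) * z ^ n"
  have eq: "?a 0 (Suc n) = - \<nu> * z * ?a (1 - \<nu>) n" for n
  proof -
    let ?y = "real (Suc n) * (- \<nu>)"
    have "?a 0 (Suc n) = (1 / Gamma ?y) * (z * z ^ n) / (real (Suc n) * fact n)"
      by (simp del: of_nat_Suc)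
    also have "1 / Gamma ?y = ?y / Gamma (?y + 1)" by (rule rGamma_shift)
    also have "?y + 1 = real n * (- \<nu>) + (1 - \<nu>)" by (simp add: algebra_simps)
    finally show ?thesis by (simp del: of_nat_Suc add: field_simps)
  qed
  have "Wright z (- \<nu>) 0 = (\<Sum>n. ?a 0 (Suc n)) + ?a 0 0"
    unfolding Wright_powser using summable_Wright[OF assms, of 0 z] by (subst suminf_split_head) auto
  \<comment> \<open>\<open>Gamma 0\<close> is 0 by convention, so the head term is a division by 0
    with value 0, the correct value of the reciprocal Gamma function.\<close>
  also have "?a 0 0 = 0" by simp
  also have "(\<Sum>n. ?a 0 (Suc n)) = - \<nu> * z * Wright z (- \<nu>) (1 - \<nu>)"
    unfolding eq Wright_powser using assms by (intro suminf_mult summable_Wright) auto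
  finally show ?thesis by simp
qed

text \<open>For \<open>b = 0\<close> and \<open>x > 0\<close> this is the one-sided stable density
  of index \<nu>, with Laplace transform exp (- x s^\<nu>); for b between 0 and 1 it is the
  fractional integral of order b of that density.\<close>

definition stable_density :: "real \<Rightarrow> real \<Rightarrow> real \<Rightarrow> real \<Rightarrow> real" where
  "stable_density \<nu> b x t = t powr (b - 1) * Wright (- (x * t powr (- \<nu>))) (- \<nu>) b"

text \<open>Both sides are the imaginary part of
  \<open>cis (pi * b) * exp (- y * cis (- (pi * \<nu>)))\<close>.\<close>

lemma stable_kernel_series:
  fixes \<nu> b y :: real
  shows "(\<lambda>n. (- y) ^ n / fact n * sin (pi * (b - \<nu> * real n)))
           sums (exp (- (y * cos (pi * \<nu>))) * sin (pi * b + y * sin (pi * \<nu>)))"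
proof -
  let ?w = "- of_real y * cis (- (pi * \<nu>))"
  have "(\<lambda>n. cis (pi * b) * (?w ^ n /\<^sub>R fact n)) sums (cis (pi * b) * exp ?w)"
    by (intro sums_mult exp_converges)
  hence "(\<lambda>n. Im (cis (pi * b) * (?w ^ n /\<^sub>R fact n))) sums Im (cis (pi * b) * exp ?w)"
    by (rule sums_Im)
  moreover have "Im (cis (pi * b) * (?w ^ n /\<^sub>R fact n)) = (- y) ^ n / fact n * sin (pi * (b - \<nu> * real n))" for n
  proof -
    have "cis (pi * b) * (?w ^ n /\<^sub>R fact n) = of_real ((- y) ^ n / fact n) * (cis (pi * b) * cis (real n * - (pi * \<nu>)))"
    proof -
      have "?w ^ n = of_real ((- y) ^ n) * cis (real n * - (pi * \<nu>))"
        by (subst Complex.DeMoivre[symmetric]) (simp only: power_mult_distrib of_real_power of_real_minus)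
      thus ?thesis by (simp only: scaleR_conv_of_real of_real_divide of_real_inverse of_real_mult of_real_fact of_real_power of_real_minus divide_inverse mult_ac)
    qed
    also have "cis (pi * b) * cis (real n * - (pi * \<nu>)) = cis (pi * (b - \<nu> * real n))"
      by (simp add: cis_mult algebra_simps)
    finally show ?thesis
      by (simp only: times_complex.sel Re_complex_of_real Im_complex_of_real cis.sel)
  qed
  moreover have "Im (cis (pi * b) * exp ?w) = exp (- (y * cos (pi * \<nu>))) * sin (pi * b + y * sin (pi * \<nu>))"
    by (simp add: Re_exp Im_exp sin_add algebra_simps)
  ultimately show ?thesis by simp
qed

text \<open>The exchange of sum and integral drops the sines. The absolute series then sums to a
  growing exponential of \<open>p powr \<nu>\<close>, so it is \<open>exp (- (t * p))\<close>, not
  the decay of the kernel, that justifies the exchange.\<close>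

lemma stable_density_integral:
  fixes \<nu> b x t :: real
  assumes \<nu>: "0 < \<nu>" "\<nu> < 1/2" and b: "b < 1" and x: "0 < x" and t: "0 < t"
  shows "has_bochner_integral halfline (\<lambda>p. exp (- (t * p)) * stable_kernel \<nu> b x p) (pi * stable_density \<nu> b x t)"
proof -
  define c where "c = (\<lambda>n. (- x) ^ n / fact n * sin (pi * (b - \<nu> * real n)))"
  define f where "f = (\<lambda>n p. c n * (p powr (\<nu> * real n + (1 - b) - 1) * exp (- (t * p))))"
  let ?A = "\<lambda>n. Gamma (\<nu> * real n + (1 - b)) / t powr (\<nu> * real n + (1 - b))"
  have pos: "0 < \<nu> * real n + (1 - b)" for n using \<nu> b by (intro add_nonneg_pos) auto
  have base: "has_bochner_integral halfline (\<lambda>p. p powr (\<nu> * real n + (1 - b) - 1) * exp (- (t * p))) (?A n)" for n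
    using powr_exp_integral_halfline[OF pos t] .
  have f: "has_bochner_integral halfline (f n) (c n * ?A n)" for n
    unfolding f_def by (rule has_bochner_integral_mult_right) (rule base)
  have fn: "has_bochner_integral halfline (\<lambda>p. norm (f n p)) (\<bar>c n\<bar> * ?A n)" for n
    using has_bochner_integral_mult_right[OF base, of "\<bar>c n\<bar>"] by (simp add: f_def abs_mult)
  have A0: "0 \<le> ?A n" for n using pos[of n] by (intro divide_nonneg_nonneg less_imp_le[OF Gamma_real_pos]) auto
  have sumn: "summable (\<lambda>n. \<integral>p. norm (f n p) \<partial>halfline)"
  proof (rule summable_comparison_test')
    show "summable (\<lambda>n. x ^ n / fact n * ?A n)"
      using \<nu> t x b by (intro summable_Gamma_over_fact) auto
    fix n
    have "\<bar>c n\<bar> = x ^ n / fact n * \<bar>sin (pi * (b - \<nu> * real n))\<bar>" using x by (simp add: c_def abs_mult power_abs)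
    also have "\<dots> \<le> x ^ n / fact n * 1" using x by (intro mult_left_mono abs_sin_le_one) auto
    finally have "\<bar>c n\<bar> * ?A n \<le> x ^ n / fact n * ?A n" using A0[of n] by (intro mult_right_mono) auto
    moreover have "(\<integral>p. norm (f n p) \<partial>halfline) = \<bar>c n\<bar> * ?A n"
      using fn[of n] by (rule has_bochner_integral_integral_eq)
    moreover have "0 \<le> \<bar>c n\<bar> * ?A n" using A0[of n] by (intro mult_nonneg_nonneg) auto
    ultimately show "norm (\<integral>p. norm (f n p) \<partial>halfline) \<le> x ^ n / fact n * ?A n"
      by (simp only: real_norm_def abs_of_nonneg)
  qed
  have feq: "f n p = (p powr (- b) * exp (- (t * p))) * ((- (x * p powr \<nu>)) ^ n / fact n * sin (pi * (b - \<nu> * real n)))"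
    if p: "0 < p" for n p
  proof -
    have "p powr (\<nu> * real n + (1 - b) - 1) = p powr (- b) * (p powr \<nu>) ^ n"
      using p by (simp add: powr_realpow[symmetric] powr_powr powr_add[symmetric])
    moreover have "(- (x * p powr \<nu>)) ^ n = (- x) ^ n * (p powr \<nu>) ^ n"
      by (simp add: power_mult_distrib[symmetric])
    ultimately show ?thesis by (simp add: f_def c_def)
  qed
  have sums: "(\<lambda>n. f n p) sums (exp (- (t * p)) * stable_kernel \<nu> b x p)" if p: "0 < p" for p
    using sums_mult[OF stable_kernel_series[of "x * p powr \<nu>" b \<nu>], of "p powr (- b) * exp (- (t * p))"]
    by (simp add: feq[OF p] stable_kernel_def mult_ac)
  have norms: "summable (\<lambda>n. norm (f n p))" if p: "0 < p" for p
  proof (rule summable_comparison_test')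
    show "summable (\<lambda>n. (p powr (- b) * exp (- (t * p))) * ((x * p powr \<nu>) ^ n /\<^sub>R fact n))"
      by (intro summable_mult summable_exp_generic)
    fix n
    have "\<bar>(- (x * p powr \<nu>)) ^ n / fact n\<bar> * \<bar>sin (pi * (b - \<nu> * real n))\<bar> \<le> \<bar>(- (x * p powr \<nu>)) ^ n / fact n\<bar> * 1"
      by (intro mult_left_mono abs_sin_le_one) auto
    hence "(p powr (- b) * exp (- (t * p))) * (\<bar>(- (x * p powr \<nu>)) ^ n / fact n\<bar> * \<bar>sin (pi * (b - \<nu> * real n))\<bar>)
       \<le> (p powr (- b) * exp (- (t * p))) * (\<bar>(- (x * p powr \<nu>)) ^ n / fact n\<bar> * 1)"
      by (intro mult_left_mono) auto
    thus "norm (norm (f n p)) \<le> (p powr (- b) * exp (- (t * p))) * ((x * p powr \<nu>) ^ n /\<^sub>R fact n)"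
      using x by (simp add: feq[OF p] abs_mult power_abs divide_inverse mult_ac)
  qed
  have fi: "integrable halfline (f n)" for n using f by (simp add: has_bochner_integral_iff)
  have AEs: "AE p in halfline. summable (\<lambda>n. norm (f n p))" using norms by (rule AE_halfline)
  have AEe: "AE p in halfline. (\<Sum>n. f n p) = exp (- (t * p)) * stable_kernel \<nu> b x p"
    using sums by (intro AE_halfline) (simp add: sums_iff)
  have "integrable halfline (\<lambda>p. \<Sum>n. f n p)"
    by (rule integrable_suminf[OF fi AEs sumn])
  hence int: "integrable halfline (\<lambda>p. exp (- (t * p)) * stable_kernel \<nu> b x p)"
    by (rule Bochner_Integration.integrable_cong_AE_imp) (use AEe in auto)
  \<comment> \<open>The reflection formula merges Gamma and sine into pi times a reciprocal Gamma
    value.\<close>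
  have terms: "c n * ?A n = pi * t powr (b - 1) * ((1 / (fact n * Gamma (real n * (- \<nu>) + b))) * (- (x * t powr (- \<nu>))) ^ n)" for n
  proof -
    let ?y = "real n * (- \<nu>) + b"
    have "?y < 1" using pos[of n] by (simp add: algebra_simps)
    from rGamma_reflection[OF this] have "Gamma (\<nu> * real n + (1 - b)) * sin (pi * (b - \<nu> * real n)) = pi * (1 / Gamma ?y)"
      by (simp add: algebra_simps)
    moreover have "(- (x * t powr (- \<nu>))) ^ n = (- x) ^ n * (t powr (- \<nu>)) ^ n"
      by (simp add: power_mult_distrib[symmetric])
    moreover have "1 / t powr (\<nu> * real n + (1 - b)) = t powr (b - 1) * (t powr (- \<nu>)) ^ n"
      using t by (simp add: powr_realpow[symmetric] powr_powr powr_add[symmetric] powr_minus_divide[symmetric] algebra_simps)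
    ultimately show ?thesis unfolding c_def divide_inverse by (simp add: mult_ac)
  qed
  have "(\<integral>p. exp (- (t * p)) * stable_kernel \<nu> b x p \<partial>halfline) = (\<integral>p. (\<Sum>n. f n p) \<partial>halfline)"
    using AEe int fi by (intro integral_cong_AE) (auto elim!: eventually_mono)
  also have "\<dots> = (\<Sum>n. c n * ?A n)"
    using integral_suminf[OF fi AEs sumn] has_bochner_integral_integral_eq[OF f] by (simp only:)
  also have "\<dots> = pi * stable_density \<nu> b x t"
    unfolding terms stable_density_def Wright_powser
    using summable_Wright[of \<nu> b "- (x * t powr (- \<nu>))"] \<nu> b
    by (subst suminf_mult) (simp_all add: mult.assoc)
  finally show ?thesis using int by (simp add: has_bochner_integral_iff)
qed

section \<open>Stable densities and their fractional integrals\<close>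

lemma halfline_measurable_ident: "(\<lambda>x. x) \<in> borel_measurable halfline"
  by (rule halfline_measurable) simp

lemma fst_halfline_measurable [measurable]: "fst \<in> borel_measurable (halfline \<Otimes>\<^sub>M M)"
  by (rule measurable_compose[OF measurable_fst halfline_measurable_ident])

lemma snd_halfline_measurable [measurable]: "snd \<in> borel_measurable (M \<Otimes>\<^sub>M halfline)"
  by (rule measurable_compose[OF measurable_snd halfline_measurable_ident])

lemma exp_integral_halfline:
  assumes "0 < a"
  shows "has_bochner_integral halfline (\<lambda>t. exp (- (a * t))) (1 / a :: real)"
proof -
  have *: "has_bochner_integral halfline (\<lambda>t. t powr (1 - 1) * exp (- (a * t))) (1 / a)"
    using powr_exp_integral_halfline[of 1 a] assms by simp
  have "has_bochner_integral halfline (\<lambda>t. t powr (1 - 1) * exp (- (a * t))) (1 / a) \<longleftrightarrow>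
     has_bochner_integral halfline (\<lambda>t. exp (- (a * t))) (1 / a)"
    by (rule has_bochner_integral_cong) (auto simp: space_restrict_space)
  with * show ?thesis by simp
qed

context
  fixes \<nu> :: real
  assumes \<nu>: "0 < \<nu>" "\<nu> < 1/2"
begin

lemma stable_density_continuous:
  assumes "b \<le> 1"
  shows "continuous_on {0<..} (stable_density \<nu> b x)"
proof -
  have W: "continuous_on UNIV (\<lambda>z. Wright z (- \<nu>) b)"
    using has_derivative_Wright[of \<nu> b] \<nu> assms by (intro DERIV_continuous_on[of UNIV]) auto
  show ?thesis unfolding stable_density_def
    by (intro continuous_intros continuous_on_compose2[OF W]) auto
qed

text \<open>The Wright series hides this as \<open>t\<close> tends to 0, where its argument tends to
  minus infinity; the integral of the absolute kernel is a bound for all \<open>t\<close> at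
  once.\<close>

lemma stable_density_bounded:
  assumes "b < 1" "0 < x"
  obtains C where "\<And>t. 0 < t \<Longrightarrow> \<bar>stable_density \<nu> b x t\<bar> \<le> C"
proof -
  let ?C = "(\<integral>p. \<bar>stable_kernel \<nu> b x p\<bar> \<partial>halfline) / pi"
  have i: "integrable halfline (stable_kernel \<nu> b x)" using stable_kernel_integrable \<nu> assms by auto
  have "\<bar>stable_density \<nu> b x t\<bar> \<le> ?C" if t: "0 < t" for t
  proof -
    note h = stable_density_integral[OF \<nu> assms t]
    have "pi * \<bar>stable_density \<nu> b x t\<bar> = norm (\<integral>p. exp (- (t * p)) * stable_kernel \<nu> b x p \<partial>halfline)"
      using has_bochner_integral_integral_eq[OF h] by (simp add: abs_mult)
    also have "\<dots> \<le> (\<integral>p. norm (exp (- (t * p)) * stable_kernel \<nu> b x p) \<partial>halfline)"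
      by (rule integral_norm_bound)
    also have "\<dots> \<le> (\<integral>p. \<bar>stable_kernel \<nu> b x p\<bar> \<partial>halfline)"
    proof (rule integral_mono_AE)
      show "integrable halfline (\<lambda>p. norm (exp (- (t * p)) * stable_kernel \<nu> b x p))"
        using h by (intro integrable_norm) (simp add: has_bochner_integral_iff)
      show "integrable halfline (\<lambda>p. \<bar>stable_kernel \<nu> b x p\<bar>)" using i by (rule integrable_abs)
      show "AE p in halfline. norm (exp (- (t * p)) * stable_kernel \<nu> b x p) \<le> \<bar>stable_kernel \<nu> b x p\<bar>"
        using t by (intro AE_halfline) (simp add: abs_mult mult_left_le_one_le)
    qed
    finally show ?thesis by (simp add: field_simps)
  qed
  thus ?thesis by (rule that)
qed

text \<open>An iterated Laplace transform is a Stieltjes transform, since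
  \<open>exp (- ((s + p) * t))\<close> integrates to \<open>1 / (s + p)\<close>. Fubini applies
  because the Stieltjes integral converges absolutely.\<close>

lemma laplace_stable_density:
  assumes b: "0 \<le> b" "b < 1" and x: "0 < x" and s: "0 < s"
  shows "has_bochner_integral halfline (\<lambda>t. exp (- (s * t)) * stable_density \<nu> b x t)
           (s powr (- b) * exp (- (x * s powr \<nu>)))"
proof -
  let ?k = "stable_kernel \<nu> b x"
  let ?F = "\<lambda>p t. exp (- ((s + p) * t)) * ?k p"
  note st = stieltjes_stable_kernel[OF \<nu> b x s]
  have inner: "has_bochner_integral halfline (\<lambda>t. ?F p t) (?k p / (s + p))" if "0 < p" for p
    using has_bochner_integral_mult_left[OF exp_integral_halfline[of "s + p"], of "?k p"] s that by simp
  have inner_norm: "(\<integral>t. norm (?F p t) \<partial>halfline) = norm (?k p / (s + p))" if "0 < p" for p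
    using has_bochner_integral_integral_eq[OF has_bochner_integral_mult_left[OF exp_integral_halfline[of "s + p"], of "\<bar>?k p\<bar>"]] s that
    by (simp add: abs_mult)
  have F: "integrable (halfline \<Otimes>\<^sub>M halfline) (case_prod ?F)"
  proof (rule halfline_pair.Fubini_integrable)
    show "case_prod ?F \<in> borel_measurable (halfline \<Otimes>\<^sub>M halfline)" by measurable
    have "integrable halfline (\<lambda>p. norm (?k p / (s + p)))"
      using st by (intro integrable_norm) (simp add: has_bochner_integral_iff)
    thus "integrable halfline (\<lambda>p. \<integral>t. norm (case_prod ?F (p, t)) \<partial>halfline)"
    proof (rule Bochner_Integration.integrable_cong[THEN iffD1, rotated 2])
      fix p assume "p \<in> space halfline"
      hence "0 < p" by (simp add: space_restrict_space)
      thus "norm (?k p / (s + p)) = (\<integral>t. norm (case_prod ?F (p, t)) \<partial>halfline)"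
        by (simp only: prod.case inner_norm)
    qed simp
    show "AE p in halfline. integrable halfline (\<lambda>t. case_prod ?F (p, t))"
      using inner by (intro AE_halfline) (simp add: has_bochner_integral_iff)
  qed
  have mid: "(\<integral>p. ?F p t \<partial>halfline) = pi * (exp (- (s * t)) * stable_density \<nu> b x t)" if "0 < t" for t
  proof -
    have "has_bochner_integral halfline (\<lambda>p. exp (- (s * t)) * (exp (- (t * p)) * ?k p)) (exp (- (s * t)) * (pi * stable_density \<nu> b x t))"
      by (rule has_bochner_integral_mult_right) (rule stable_density_integral[OF \<nu> b(2) x that])
    moreover have "exp (- (s * t)) * (exp (- (t * p)) * ?k p) = ?F p t" for p
      by (simp add: exp_add[symmetric] algebra_simps)
    ultimately show ?thesis by (simp add: has_bochner_integral_integral_eq)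
  qed
  have "integrable halfline (\<lambda>t. \<integral>p. ?F p t \<partial>halfline)"
    by (rule halfline_pair.integrable_snd[OF F])
  hence i: "integrable halfline (\<lambda>t. pi * (exp (- (s * t)) * stable_density \<nu> b x t))"
    by (rule Bochner_Integration.integrable_cong[THEN iffD1, rotated 2]) (auto simp: mid space_restrict_space)
  have "pi * (\<integral>t. exp (- (s * t)) * stable_density \<nu> b x t \<partial>halfline) = (\<integral>t. (\<integral>p. ?F p t \<partial>halfline) \<partial>halfline)"
    unfolding integral_mult_right_zero[symmetric]
    by (rule Bochner_Integration.integral_cong) (auto simp: mid space_restrict_space)
  also have "\<dots> = (\<integral>p. (\<integral>t. ?F p t \<partial>halfline) \<partial>halfline)" by (rule halfline_pair.Fubini_integral[OF F])
  also have "\<dots> = (\<integral>p. ?k p / (s + p) \<partial>halfline)"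
    by (intro Bochner_Integration.integral_cong refl has_bochner_integral_integral_eq inner)
       (simp add: space_restrict_space)
  also have "\<dots> = pi * (s powr (- b) * exp (- (x * s powr \<nu>)))"
    using st by (rule has_bochner_integral_integral_eq)
  finally show ?thesis using i by (simp add: has_bochner_integral_iff)
qed

lemma stable_density_0_nonneg:
  assumes "0 < x" "0 < t"
  shows "0 \<le> stable_density \<nu> 0 x t"
proof (rule laplace_alternating_imp_nonneg[OF _ _ _ assms(2)])
  show "has_bochner_integral halfline (\<lambda>t. exp (- (s * t)) * stable_density \<nu> 0 x t) (exp (- (x * s powr \<nu>)))"
    if "0 < s" for s using laplace_stable_density[of 0 x s] assms that by simp
  show "alternating_derivs (\<lambda>s. exp (- (x * s powr \<nu>)))"
    using \<nu> assms by (intro alternating_derivs_exp_powr) auto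
  show "continuous_on {0<..} (stable_density \<nu> 0 x)" by (rule stable_density_continuous) simp
qed

section \<open>Fractional integration of the stable density\<close>

text \<open>The convolution integrand in the lag \<open>u\<close>, the time elapsed since \<tau>.
  The cutoff lets the integrals for all \<open>t\<close> live on one measure, as dominated
  convergence and Fubini require.\<close>

definition fractional_integrand :: "real \<Rightarrow> real \<Rightarrow> real \<Rightarrow> real \<Rightarrow> real" where
  "fractional_integrand \<alpha> x t u = u powr (- \<alpha>) * (indicator {0<..} (t - u) * stable_density \<nu> 0 x (t - u))"

lemma zero_extended_stable_density_measurable [measurable]:
  "(\<lambda>t. indicator {0<..} t * stable_density \<nu> 0 x t) \<in> borel_measurable borel"
  using borel_measurable_continuous_on_indicator[OF _ stable_density_continuous[of 0 x]] by simp

text \<open>Where the integrand is nonzero, \<open>u < t \<le> T\<close>, so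
  \<open>exp (T - u)\<close> is at least 1; inserting it makes the bound integrable over the whole
  half-line and independent of \<open>t\<close>.\<close>

lemma fractional_integrand_bound:
  assumes "\<alpha> < 1" "0 < x"
  obtains C where "\<And>T. integrable halfline (\<lambda>u. C * exp T * (u powr (- \<alpha>) * exp (- u)))"
    "\<And>t u T. t \<le> T \<Longrightarrow> \<bar>fractional_integrand \<alpha> x t u\<bar> \<le> C * exp T * (u powr (- \<alpha>) * exp (- u))"
proof -
  obtain C where C: "\<And>t. 0 < t \<Longrightarrow> \<bar>stable_density \<nu> 0 x t\<bar> \<le> C"
    using stable_density_bounded[of 0 x] assms by auto
  have C0: "0 \<le> C" using C[of 1] by linarith
  have "\<bar>fractional_integrand \<alpha> x t u\<bar> \<le> C * exp T * (u powr (- \<alpha>) * exp (- u))" if "t \<le> T" for t u T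
  proof (cases "u < t")
    case True
    have "\<bar>stable_density \<nu> 0 x (t - u)\<bar> \<le> C * 1" using C True by simp
    also have "\<dots> \<le> C * exp (T - u)" using C0 True that by (intro mult_left_mono) auto
    finally have "u powr (- \<alpha>) * \<bar>stable_density \<nu> 0 x (t - u)\<bar> \<le> u powr (- \<alpha>) * (C * exp (T - u))"
      by (intro mult_left_mono) auto
    thus ?thesis using True by (simp add: fractional_integrand_def abs_mult exp_diff exp_minus field_simps)
  qed (use C0 in \<open>simp add: fractional_integrand_def\<close>)
  moreover have "integrable halfline (\<lambda>u. C * exp T * (u powr (- \<alpha>) * exp (- u)))" for T
    using powr_exp_integral_halfline[of "1 - \<alpha>" 1] assms
    by (intro integrable_mult_right) (simp add: has_bochner_integral_iff)
  ultimately show ?thesis by (rule that[rotated])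
qed

lemma fractional_integrand_measurable: "fractional_integrand \<alpha> x t \<in> borel_measurable borel"
proof -
  have "(\<lambda>u. indicator {0<..} (t - u) * stable_density \<nu> 0 x (t - u)) \<in> borel_measurable borel"
    by (rule measurable_compose[OF _ zero_extended_stable_density_measurable]) measurable
  thus ?thesis unfolding fractional_integrand_def[abs_def] by (rule borel_measurable_times[rotated]) measurable
qed

lemma fractional_integrand_integrable:
  assumes "\<alpha> < 1" "0 < x"
  shows "integrable halfline (fractional_integrand \<alpha> x t)"
proof -
  obtain C where C: "\<And>T. integrable halfline (\<lambda>u. C * exp T * (u powr (- \<alpha>) * exp (- u)))"
    "\<And>t u T. t \<le> T \<Longrightarrow> \<bar>fractional_integrand \<alpha> x t u\<bar> \<le> C * exp T * (u powr (- \<alpha>) * exp (- u))"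
    using fractional_integrand_bound assms by blast
  show ?thesis
  proof (rule Bochner_Integration.integrable_bound[OF C(1)[of t]])
    show "AE u in halfline. norm (fractional_integrand \<alpha> x t u) \<le> norm (C * exp t * (u powr (- \<alpha>) * exp (- u)))"
      using C(2)[of t t] by (intro AE_halfline) (auto intro: order_trans[OF _ abs_ge_self])
  qed (intro halfline_measurable fractional_integrand_measurable)
qed

text \<open>Uniqueness of the Laplace transform compares continuous functions, so the convolution
  has to be one.\<close>

lemma fractional_integral_continuous:
  assumes "\<alpha> < 1" "0 < x"
  shows "continuous_on {0<..} (\<lambda>t. \<integral>u. fractional_integrand \<alpha> x t u \<partial>halfline)"
  unfolding continuous_on_sequentially comp_def
proof (intro allI ballI impI, elim conjE)
  fix X :: "nat \<Rightarrow> real" and t :: real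
  assume X: "X \<longlonglongrightarrow> t"
  obtain C where C: "\<And>T. integrable halfline (\<lambda>u. C * exp T * (u powr (- \<alpha>) * exp (- u)))"
    "\<And>t u T. t \<le> T \<Longrightarrow> \<bar>fractional_integrand \<alpha> x t u\<bar> \<le> C * exp T * (u powr (- \<alpha>) * exp (- u))"
    using fractional_integrand_bound assms by blast
  have "Bseq X" using X by (intro convergent_imp_Bseq) (auto simp: convergent_def)
  then obtain T where T: "\<And>n. X n \<le> T" unfolding Bseq_def by (metis abs_le_D1 real_norm_def)
  show "(\<lambda>n. \<integral>u. fractional_integrand \<alpha> x (X n) u \<partial>halfline) \<longlonglongrightarrow> (\<integral>u. fractional_integrand \<alpha> x t u \<partial>halfline)"
  proof (rule integral_dominated_convergence[OF _ _ C(1)[of T]])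
    show "AE u in halfline. norm (fractional_integrand \<alpha> x (X n) u) \<le> C * exp T * (u powr (- \<alpha>) * exp (- u))" for n
      using C(2)[OF T] by (intro AE_halfline) simp
    \<comment> \<open>At \<open>u = t\<close> the cutoff may jump along the sequence; that single
      point is null.\<close>
    have lim: "(\<lambda>n. fractional_integrand \<alpha> x (X n) u) \<longlonglongrightarrow> fractional_integrand \<alpha> x t u" if "u \<noteq> t" for u
    proof (cases "u < t")
      case True
      have "isCont (stable_density \<nu> 0 x) (t - u)"
        using stable_density_continuous[of 0 x] True by (simp add: continuous_on_eq_continuous_at)
      hence "(\<lambda>n. stable_density \<nu> 0 x (X n - u)) \<longlonglongrightarrow> stable_density \<nu> 0 x (t - u)"
        by (rule isCont_tendsto_compose) (intro tendsto_intros X)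
      hence "(\<lambda>n. u powr (- \<alpha>) * stable_density \<nu> 0 x (X n - u)) \<longlonglongrightarrow> u powr (- \<alpha>) * stable_density \<nu> 0 x (t - u)"
        by (intro tendsto_intros)
      moreover have "eventually (\<lambda>n. u < X n) sequentially" using X True by (rule order_tendstoD)
      hence "eventually (\<lambda>n. u powr (- \<alpha>) * stable_density \<nu> 0 x (X n - u) = fractional_integrand \<alpha> x (X n) u) sequentially"
        by eventually_elim (simp add: fractional_integrand_def)
      ultimately show ?thesis using True
        by (simp add: tendsto_cong fractional_integrand_def)
    next
      case False
      hence "t < u" using that by simp
      hence "eventually (\<lambda>n. X n < u) sequentially" using X by (intro order_tendstoD)
      hence "eventually (\<lambda>n. fractional_integrand \<alpha> x (X n) u = 0) sequentially"
        by eventually_elim (simp add: fractional_integrand_def)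
      thus ?thesis using False by (simp add: fractional_integrand_def tendsto_eventually)
    qed
    have "AE u in lborel. u \<noteq> t" by (rule AE_lborel_singleton)
    hence "AE u in lborel. 0 < u \<longrightarrow> (\<lambda>n. fractional_integrand \<alpha> x (X n) u) \<longlonglongrightarrow> fractional_integrand \<alpha> x t u"
      by eventually_elim (use lim in auto)
    thus "AE u in halfline. (\<lambda>n. fractional_integrand \<alpha> x (X n) u) \<longlonglongrightarrow> fractional_integrand \<alpha> x t u"
      by (subst AE_restrict_space_iff) auto
  qed (intro halfline_measurable fractional_integrand_measurable)+
qed

text \<open>The convolution theorem: the power contributes
  \<open>Gamma (1 - \<alpha>) * s powr (- (1 - \<alpha>))\<close>, the density its own
  transform.\<close>

lemma laplace_fractional_integral:
  assumes \<alpha>: "0 \<le> \<alpha>" "\<alpha> < 1" and x: "0 < x" and s: "0 < s"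
  shows "has_bochner_integral halfline (\<lambda>t. exp (- (s * t)) * (\<integral>u. fractional_integrand \<alpha> x t u \<partial>halfline))
           (Gamma (1 - \<alpha>) * (s powr (- (1 - \<alpha>)) * exp (- (x * s powr \<nu>))))"
proof -
  let ?G = "\<lambda>t. indicator {0<..} t * stable_density \<nu> 0 x t :: real"
  let ?F = "\<lambda>u t. exp (- (s * t)) * fractional_integrand \<alpha> x t u"
  let ?L = "exp (- (x * s powr \<nu>))"
  have Gm: "?G \<in> borel_measurable borel" by measurable
  have L: "has_bochner_integral lborel (\<lambda>t. exp (- (s * t)) * ?G t) ?L"
    using laplace_stable_density[of 0 x s] x s
    by (simp add: has_bochner_integral_iff integrable_halfline_iff integral_halfline_eq mult_ac)
  have inner: "has_bochner_integral halfline (?F u) (u powr (- \<alpha>) * exp (- (s * u)) * ?L)" if u: "0 < u" for u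
  proof -
    have "has_bochner_integral lborel (\<lambda>t. exp (- (s * (- u + 1 * t))) * ?G (- u + 1 * t)) (?L /\<^sub>R \<bar>1\<bar>)"
      using L by (subst (asm) lborel_has_bochner_integral_real_affine_iff[of 1 _ _ "- u"]) auto
    from has_bochner_integral_mult_right[OF this, of "u powr (- \<alpha>) * exp (- (s * u))"]
    have "has_bochner_integral lborel (\<lambda>t. u powr (- \<alpha>) * exp (- (s * u)) * (exp (- (s * (- u + 1 * t))) * ?G (- u + 1 * t)))
       (u powr (- \<alpha>) * exp (- (s * u)) * ?L)" by simp
    also have "(\<lambda>t. u powr (- \<alpha>) * exp (- (s * u)) * (exp (- (s * (- u + 1 * t))) * ?G (- u + 1 * t))) =
       (\<lambda>t. indicator {0<..} t *\<^sub>R ?F u t)"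
    proof
      fix t
      have "exp (- (s * u)) * exp (- (s * (- u + 1 * t))) = exp (- (s * t))"
        by (simp add: exp_add[symmetric] algebra_simps)
      moreover have "indicator {0<..} t * ?G (- u + 1 * t) = ?G (- u + 1 * t)"
        using u by (auto simp: indicator_def)
      ultimately show "u powr (- \<alpha>) * exp (- (s * u)) * (exp (- (s * (- u + 1 * t))) * ?G (- u + 1 * t)) = indicator {0<..} t *\<^sub>R ?F u t"
        by (simp add: fractional_integrand_def mult_ac)
    qed
    finally show ?thesis by (simp add: has_bochner_integral_iff integrable_halfline_iff integral_halfline_eq)
  qed
  \<comment> \<open>Nonnegativity of the density, already known from its transform, makes the
    absolute integrals equal to the plain ones.\<close>
  have inner_norm: "(\<integral>t. norm (?F u t) \<partial>halfline) = u powr (- \<alpha>) * exp (- (s * u)) * ?L" if u: "0 < u" for u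
  proof -
    have "norm (?F u t) = ?F u t" for t
      using stable_density_0_nonneg[OF x, of "t - u"]
      by (cases "u < t") (auto simp: fractional_integrand_def)
    thus ?thesis using has_bochner_integral_integral_eq[OF inner[OF u]] by simp
  qed
  have outer: "has_bochner_integral halfline (\<lambda>u. u powr (- \<alpha>) * exp (- (s * u)) * ?L)
      (Gamma (1 - \<alpha>) * (s powr (- (1 - \<alpha>)) * ?L))"
    using has_bochner_integral_mult_left[OF powr_exp_integral_halfline[of "1 - \<alpha>" s], of ?L] \<alpha> s
    by (simp add: powr_minus_divide powr_diff mult_ac)
  have m: "case_prod ?F \<in> borel_measurable (halfline \<Otimes>\<^sub>M halfline)"
  proof -
    have "(\<lambda>z. ?G (snd z - fst z)) \<in> borel_measurable (halfline \<Otimes>\<^sub>M halfline)"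
      by (rule measurable_compose[OF _ Gm]) measurable
    moreover have "(\<lambda>z. exp (- (s * snd z)) * fst z powr (- \<alpha>)) \<in> borel_measurable (halfline \<Otimes>\<^sub>M halfline)"
      by measurable
    ultimately have "(\<lambda>z. (exp (- (s * snd z)) * fst z powr (- \<alpha>)) * ?G (snd z - fst z))
       \<in> borel_measurable (halfline \<Otimes>\<^sub>M halfline)" by (rule borel_measurable_times[rotated])
    thus ?thesis by (simp add: fractional_integrand_def case_prod_beta mult.assoc)
  qed
  have F: "integrable (halfline \<Otimes>\<^sub>M halfline) (case_prod ?F)"
  proof (rule halfline_pair.Fubini_integrable[OF m])
    have "integrable halfline (\<lambda>u. u powr (- \<alpha>) * exp (- (s * u)) * ?L)"
      using outer by (simp add: has_bochner_integral_iff)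
    thus "integrable halfline (\<lambda>u. \<integral>t. norm (case_prod ?F (u, t)) \<partial>halfline)"
    proof (rule Bochner_Integration.integrable_cong[THEN iffD1, rotated 2])
      fix u assume "u \<in> space halfline"
      hence "0 < u" by (simp add: space_restrict_space)
      thus "u powr (- \<alpha>) * exp (- (s * u)) * ?L = (\<integral>t. norm (case_prod ?F (u, t)) \<partial>halfline)"
        by (simp only: prod.case inner_norm)
    qed simp
    show "AE u in halfline. integrable halfline (\<lambda>t. case_prod ?F (u, t))"
      using inner by (intro AE_halfline) (simp add: has_bochner_integral_iff)
  qed
  have pull: "(\<integral>u. ?F u t \<partial>halfline) = exp (- (s * t)) * (\<integral>u. fractional_integrand \<alpha> x t u \<partial>halfline)" for t
    by (rule integral_mult_right_zero)
  have "integrable halfline (\<lambda>t. \<integral>u. ?F u t \<partial>halfline)"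
    by (rule halfline_pair.integrable_snd[OF F])
  moreover have "(\<integral>t. (\<integral>u. ?F u t \<partial>halfline) \<partial>halfline) = (\<integral>u. (\<integral>t. ?F u t \<partial>halfline) \<partial>halfline)"
    by (rule halfline_pair.Fubini_integral[OF F])
  moreover have "(\<integral>u. (\<integral>t. ?F u t \<partial>halfline) \<partial>halfline) = (\<integral>u. u powr (- \<alpha>) * exp (- (s * u)) * ?L \<partial>halfline)"
    by (intro Bochner_Integration.integral_cong refl has_bochner_integral_integral_eq inner)
       (simp add: space_restrict_space)
  ultimately show ?thesis
    using outer unfolding pull by (simp add: has_bochner_integral_iff)
qed

text \<open>Raising \<open>b\<close> from 0 to \<open>1 - \<alpha>\<close> multiplies the transform
  by the same power of \<open>s\<close> as the convolution does.\<close>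

lemma fractional_integral_stable_density:
  assumes \<alpha>: "0 < \<alpha>" "\<alpha> < 1" and x: "0 < x" and t: "0 < t"
  shows "(\<integral>u. fractional_integrand \<alpha> x t u \<partial>halfline) = Gamma (1 - \<alpha>) * stable_density \<nu> (1 - \<alpha>) x t"
proof (rule laplace_unique[OF _ _ _ _ t])
  show "has_bochner_integral halfline (\<lambda>t. exp (- (s * t)) * (\<integral>u. fractional_integrand \<alpha> x t u \<partial>halfline))
           (Gamma (1 - \<alpha>) * (s powr (- (1 - \<alpha>)) * exp (- (x * s powr \<nu>))))" if "0 < s" for s
    using \<alpha> x that by (intro laplace_fractional_integral) auto
  show "has_bochner_integral halfline (\<lambda>t. exp (- (s * t)) * (Gamma (1 - \<alpha>) * stable_density \<nu> (1 - \<alpha>) x t))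
           (Gamma (1 - \<alpha>) * (s powr (- (1 - \<alpha>)) * exp (- (x * s powr \<nu>))))" if "0 < s" for s
    using has_bochner_integral_mult_right[OF laplace_stable_density[of "1 - \<alpha>" x s], of "Gamma (1 - \<alpha>)"] \<alpha> x that
    by (simp add: mult_ac)
  show "continuous_on {0<..} (\<lambda>t. \<integral>u. fractional_integrand \<alpha> x t u \<partial>halfline)"
    by (rule fractional_integral_continuous) fact+
  show "continuous_on {0<..} (\<lambda>t. Gamma (1 - \<alpha>) * stable_density \<nu> (1 - \<alpha>) x t)"
    using \<alpha> by (intro continuous_intros stable_density_continuous) auto
qed

lemma fractional_integral_has_integral:
  assumes \<alpha>: "0 < \<alpha>" "\<alpha> < 1" and x: "0 < x" and t: "0 < t"
  shows "((\<lambda>\<tau>. stable_density \<nu> 0 x \<tau> / (t - \<tau>) powr \<alpha>) has_integral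
            Gamma (1 - \<alpha>) * stable_density \<nu> (1 - \<alpha>) x t) {0..t}"
proof -
  let ?h = "\<lambda>\<tau>. stable_density \<nu> 0 x \<tau> / (t - \<tau>) powr \<alpha>"
  have "has_bochner_integral lborel (\<lambda>u. indicator {0<..} u *\<^sub>R fractional_integrand \<alpha> x t u)
     (Gamma (1 - \<alpha>) * stable_density \<nu> (1 - \<alpha>) x t)"
    using fractional_integral_stable_density[OF assms] fractional_integrand_integrable[OF \<alpha>(2) x, of t]
    by (simp add: has_bochner_integral_iff integrable_halfline_iff integral_halfline_eq)
  hence "has_bochner_integral lborel (\<lambda>\<tau>. indicator {0<..} (t + - 1 * \<tau>) *\<^sub>R fractional_integrand \<alpha> x t (t + - 1 * \<tau>))
     ((Gamma (1 - \<alpha>) * stable_density \<nu> (1 - \<alpha>) x t) /\<^sub>R \<bar>- 1\<bar>)"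
    by (subst (asm) lborel_has_bochner_integral_real_affine_iff[of "- 1" _ _ t]) auto
  also have "(\<lambda>\<tau>. indicator {0<..} (t + - 1 * \<tau>) *\<^sub>R fractional_integrand \<alpha> x t (t + - 1 * \<tau>)) =
     (\<lambda>\<tau>. indicator {0<..<t} \<tau> *\<^sub>R ?h \<tau>)"
    by (auto simp: fun_eq_iff fractional_integrand_def indicator_def powr_minus_divide)
  finally have h: "has_bochner_integral lborel (\<lambda>\<tau>. indicator {0<..<t} \<tau> *\<^sub>R ?h \<tau>)
      (Gamma (1 - \<alpha>) * stable_density \<nu> (1 - \<alpha>) x t)" by simp
  hence "set_integrable lborel {0<..<t} ?h" by (simp add: set_integrable_def has_bochner_integral_iff)
  from set_borel_integral_eq_integral[OF this] h
  have "(?h has_integral Gamma (1 - \<alpha>) * stable_density \<nu> (1 - \<alpha>) x t) {0<..<t}"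
    by (simp add: has_integral_iff has_bochner_integral_iff set_lebesgue_integral_def)
  thus ?thesis by (simp add: has_integral_Icc_iff_Ioo)
qed

text \<open>Up to a positive factor the value is a fractional integral of order \<open>b\<close> of
  the nonnegative density.\<close>

lemma Wright_nonneg:
  assumes b: "0 < b" "b < 1" and u: "0 < u"
  shows "0 \<le> Wright (- u) (- \<nu>) b"
proof -
  \<comment> \<open>With \<open>x = 1\<close>, this is the time at which the similarity variable
    equals \<open>u\<close>.\<close>
  define t where "t = u powr (- 1 / \<nu>)"
  have t: "0 < t" "1 * t powr (- \<nu>) = u" using u \<nu> by (auto simp: t_def powr_powr)
  have "0 \<le> (\<integral>v. fractional_integrand (1 - b) 1 t v \<partial>halfline)"
  proof (intro integral_nonneg_AE AE_halfline)
    fix v :: real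
    show "0 \<le> fractional_integrand (1 - b) 1 t v"
      using stable_density_0_nonneg[of 1 "t - v"] by (cases "v < t") (auto simp: fractional_integrand_def)
  qed
  also have "\<dots> = Gamma b * (t powr (b - 1) * Wright (- (1 * t powr (- \<nu>))) (- \<nu>) b)"
    using fractional_integral_stable_density[of "1 - b" 1 t] b t by (simp add: stable_density_def)
  finally show ?thesis unfolding t(2) using Gamma_real_pos[OF b(1)] t(1) by (simp add: zero_le_mult_iff)
qed

lemma stable_density_0_eq:
  "stable_density \<nu> 0 x t = \<nu> * x * t powr (- 1 - \<nu>) * Wright (- (x * t powr (- \<nu>))) (- \<nu>) (1 - \<nu>)"
  using \<nu> by (simp add: stable_density_def Wright_b_0 powr_add[symmetric] powr_diff powr_minus_divide)

text \<open>Differentiation lowers the parameter to \<open>1 - 2 * \<nu>\<close>, which lies between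
  0 and 1, so the previous sign result covers the derivative.\<close>

lemma Wright_kernel_antimono:
  assumes "0 < u" "u \<le> v"
  shows "Wright (- v) (- \<nu>) (1 - \<nu>) \<le> Wright (- u) (- \<nu>) (1 - \<nu>)"
proof (rule DERIV_nonpos_imp_nonincreasing[OF assms(2)])
  fix w assume "u \<le> w"
  hence "0 \<le> Wright (- w) (- \<nu>) (1 - \<nu> - \<nu>)" using assms \<nu> by (intro Wright_nonneg) auto
  moreover have "((\<lambda>w. Wright (- w) (- \<nu>) (1 - \<nu>)) has_real_derivative
     Wright (- w) (- \<nu>) (1 - \<nu> - \<nu>) * - 1) (at w)"
    using \<nu> by (intro DERIV_chain2[OF has_derivative_Wright]) (auto intro!: derivative_eq_intros)
  ultimately show "\<exists>y. ((\<lambda>w. Wright (- w) (- \<nu>) (1 - \<nu>)) has_real_derivative y) (at w) \<and> y \<le> 0"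
    by (intro exI conjI) auto
qed

text \<open>If the kernel vanished at \<open>u\<close> it would vanish beyond \<open>u\<close>, so the stable density would
  vanish near \<open>0\<close> and its Laplace transform would decay exponentially.\<close>

lemma Wright_kernel_pos:
  assumes u: "0 < u"
  shows "0 < Wright (- u) (- \<nu>) (1 - \<nu>)"
proof (rule ccontr)
  assume "\<not> ?thesis"
  hence M0: "Wright (- v) (- \<nu>) (1 - \<nu>) = 0" if "u \<le> v" for v
    using Wright_kernel_antimono[OF u that] Wright_nonneg[of "1 - \<nu>" v] \<nu> u that by auto
  \<comment> \<open>The time at which the similarity variable equals \<open>u\<close>; at earlier
    times it is larger.\<close>
  define d where "d = u powr (- 1 / \<nu>)"
  have d: "0 < d" using u by (simp add: d_def)
  let ?g = "stable_density \<nu> 0 1"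
  have g0: "?g t = 0" if "0 < t" "t \<le> d" for t
  proof -
    have "u = d powr (- \<nu>)" using u \<nu> by (simp add: d_def powr_powr)
    also have "\<dots> \<le> t powr (- \<nu>)" using that \<nu> by (intro powr_mono2') auto
    finally show ?thesis unfolding stable_density_0_eq by (simp add: M0)
  qed
  \<comment> \<open>Only \<open>t > d\<close> contributes, where
    \<open>exp (- ((s - 1) * t))\<close> is at most its value at \<open>d\<close>. One unit of
    \<open>s\<close> is held back so that the remaining integral is the transform at 1.\<close>
  have ineq: "exp (- (s powr \<nu>)) \<le> exp (- ((s - 1) * d)) * exp (- 1)" if s: "1 \<le> s" for s
  proof -
    have L: "has_bochner_integral halfline (\<lambda>t. exp (- (r * t)) * ?g t) (exp (- (r powr \<nu>)))" if "0 < r" for r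
      using laplace_stable_density[of 0 1 r] that by simp
    have "exp (- (s powr \<nu>)) = (\<integral>t. exp (- (s * t)) * ?g t \<partial>halfline)"
      using L[of s] s by (simp add: has_bochner_integral_integral_eq)
    also have "\<dots> \<le> (\<integral>t. exp (- ((s - 1) * d)) * (exp (- (1 * t)) * ?g t) \<partial>halfline)"
    proof (rule integral_mono_AE)
      show "integrable halfline (\<lambda>t. exp (- (s * t)) * ?g t)" using L[of s] s by (simp add: has_bochner_integral_iff)
      show "integrable halfline (\<lambda>t. exp (- ((s - 1) * d)) * (exp (- (1 * t)) * ?g t))"
        using L[of 1] by (intro integrable_mult_right) (simp add: has_bochner_integral_iff)
      show "AE t in halfline. exp (- (s * t)) * ?g t \<le> exp (- ((s - 1) * d)) * (exp (- (1 * t)) * ?g t)"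
      proof (rule AE_halfline)
        fix t :: real assume t: "0 < t"
        show "exp (- (s * t)) * ?g t \<le> exp (- ((s - 1) * d)) * (exp (- (1 * t)) * ?g t)"
        proof (cases "t \<le> d")
          case False
          have "(s - 1) * d \<le> (s - 1) * t" using s False by (intro mult_left_mono) auto
          hence "exp (- (s * t)) \<le> exp (- ((s - 1) * d)) * exp (- (1 * t))"
            by (simp add: exp_add[symmetric] algebra_simps)
          hence "exp (- (s * t)) * ?g t \<le> (exp (- ((s - 1) * d)) * exp (- (1 * t))) * ?g t"
            using stable_density_0_nonneg[of 1 t] t by (intro mult_right_mono) auto
          thus ?thesis by (simp only: mult.assoc)
        qed (use g0 t in simp)
      qed
    qed
    also have "\<dots> = exp (- ((s - 1) * d)) * exp (- (1 powr \<nu>))"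
      using has_bochner_integral_integral_eq[OF L[of 1]] by (simp only: integral_mult_right_zero)
    finally show ?thesis by simp
  qed
  \<comment> \<open>The contradiction: as \<open>\<nu> < 1\<close>, the left side decays faster than
    \<open>exp (- (s powr \<nu>))\<close>.\<close>
  have "eventually (\<lambda>s. exp (- ((s - 1) * d)) * exp (- 1) < exp (- (s powr \<nu>))) at_top"
    using d \<nu> by real_asymp
  moreover have "eventually (\<lambda>s :: real. 1 \<le> s) at_top" by (rule eventually_ge_at_top)
  ultimately have "eventually (\<lambda>s :: real. False) at_top"
    by eventually_elim (use ineq in \<open>simp add: not_less[symmetric]\<close>)
  thus False by simp
qed

end

section \<open>The Stefan problem\<close>

context
  fixes \<nu> :: real
  assumes \<nu>: "0 < \<nu>" "\<nu> < 1/2"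
begin

lemma one_minus_Wright_deriv:
  "((\<lambda>\<xi>. 1 - Wright (- \<xi>) (- \<nu>) 1) has_real_derivative Mainardi \<nu> \<xi>) (at \<xi>)"
proof -
  have "((\<lambda>\<xi>. Wright (- \<xi>) (- \<nu>) 1) has_real_derivative Wright (- \<xi>) (- \<nu>) (1 - \<nu>) * - 1) (at \<xi>)"
    using \<nu> by (intro DERIV_chain2[OF has_derivative_Wright]) (auto intro!: derivative_eq_intros)
  from DERIV_diff[OF DERIV_const this] show ?thesis by (simp add: Mainardi_def)
qed

lemma Mainardi_deriv:
  "(Mainardi \<nu> has_real_derivative - Wright (- \<xi>) (- \<nu>) (1 - 2 * \<nu>)) (at \<xi>)"
proof -
  have "((\<lambda>\<xi>. Wright (- \<xi>) (- \<nu>) (1 - \<nu>)) has_real_derivative Wright (- \<xi>) (- \<nu>) (1 - \<nu> - \<nu>) * - 1) (at \<xi>)"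
    using \<nu> by (intro DERIV_chain2[OF has_derivative_Wright]) (auto intro!: derivative_eq_intros)
  thus ?thesis by (simp add: Mainardi_def[abs_def])
qed

lemma Mainardi_0: "Mainardi \<nu> 0 = 1 / Gamma (1 - \<nu>)"
  by (simp add: Mainardi_def Wright_0_arg)

lemma Mainardi_pos: "0 \<le> \<xi> \<Longrightarrow> 0 < Mainardi \<nu> \<xi>"
  using Wright_kernel_pos[OF \<nu>, of \<xi>] Gamma_real_pos[of "1 - \<nu>"] \<nu>
  by (cases "\<xi> = 0") (auto simp: Mainardi_0, simp add: Mainardi_def)

lemma Mainardi_antimono:
  assumes "0 < u" "u \<le> v"
  shows "Mainardi \<nu> v \<le> Mainardi \<nu> u"
  using Wright_kernel_antimono[OF \<nu> assms] by (simp add: Mainardi_def)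

lemma one_minus_Wright_strict_mono:
  assumes "0 \<le> u" "u < v"
  shows "1 - Wright (- u) (- \<nu>) 1 < 1 - Wright (- v) (- \<nu>) 1"
  by (rule DERIV_pos_imp_increasing[OF assms(2)])
     (use assms(1) one_minus_Wright_deriv Mainardi_pos in \<open>meson order_trans\<close>)

lemma one_minus_Wright_pos: "0 < \<xi> \<Longrightarrow> 0 < 1 - Wright (- \<xi>) (- \<nu>) 1"
  using one_minus_Wright_strict_mono[of 0 \<xi>] by (simp add: Wright_0_arg)

lemma stefan_quotient_strict_mono:
  assumes "0 < u" "u < v"
  shows "u * (1 - Wright (- u) (- \<nu>) 1) / Mainardi \<nu> u < v * (1 - Wright (- v) (- \<nu>) 1) / Mainardi \<nu> v"
proof (rule frac_less)
  show "u * (1 - Wright (- u) (- \<nu>) 1) < v * (1 - Wright (- v) (- \<nu>) 1)"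
    using assms one_minus_Wright_strict_mono[of u v] one_minus_Wright_pos[of u] by (intro mult_strict_mono) auto
  show "0 \<le> u * (1 - Wright (- u) (- \<nu>) 1)" using assms one_minus_Wright_pos[of u] by simp
qed (use assms Mainardi_pos[of v] Mainardi_antimono[of u v] in auto)

lemma stefan_equation_unique_solution:
  assumes K: "0 < K"
  shows "\<exists>!\<xi>. 0 < \<xi> \<and> \<xi> * (1 - Wright (- \<xi>) (- \<nu>) 1) / Mainardi \<nu> \<xi> = K"
proof -
  let ?N = "\<lambda>\<xi>. 1 - Wright (- \<xi>) (- \<nu>) 1"
  let ?f = "\<lambda>\<xi>. \<xi> * ?N \<xi> / Mainardi \<nu> \<xi>"
  \<comment> \<open>An upper end for the intermediate value theorem, found by replacing numerator
    and Mainardi function by their values at 1; beyond 1 monotonicity only enlarges the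
    quotient.\<close>
  define b where "b = max 1 (K * Mainardi \<nu> 1 / ?N 1)"
  have b: "1 \<le> b" "K * Mainardi \<nu> 1 / ?N 1 \<le> b" by (auto simp: b_def)
  have N1: "0 < ?N 1" by (rule one_minus_Wright_pos) simp
  have "?N 1 \<le> ?N b" using one_minus_Wright_strict_mono[of 1 b] b by (cases "b = 1") auto
  have "K * Mainardi \<nu> b \<le> K * Mainardi \<nu> 1" using K b Mainardi_antimono[of 1 b] by (intro mult_left_mono) auto
  also have "\<dots> \<le> b * ?N 1" using b(2) N1 by (simp add: pos_divide_le_eq)
  also have "\<dots> \<le> b * ?N b" using b \<open>?N 1 \<le> ?N b\<close> by (intro mult_left_mono) auto
  finally have Kb: "K \<le> ?f b" using Mainardi_pos[of b] b by (subst pos_le_divide_eq) auto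
  have "isCont ?f \<xi>" if "0 \<le> \<xi>" for \<xi>
    using Mainardi_pos[OF that]
    by (intro continuous_intros DERIV_isCont[OF one_minus_Wright_deriv] DERIV_isCont[OF Mainardi_deriv]) auto
  hence "\<exists>\<xi>\<ge>0. \<xi> \<le> b \<and> ?f \<xi> = K"
    using K Kb b by (intro IVT) auto
  then obtain \<xi> where \<xi>: "0 \<le> \<xi>" "?f \<xi> = K" by blast
  have "\<xi> \<noteq> 0" using \<xi> K by auto
  with \<xi> have ex: "0 < \<xi> \<and> ?f \<xi> = K" by auto
  show ?thesis
  proof (rule ex1I[of _ \<xi>])
    show "0 < \<xi> \<and> ?f \<xi> = K" by (rule ex)
    fix \<eta> assume \<eta>: "0 < \<eta> \<and> ?f \<eta> = K"
    show "\<eta> = \<xi>"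
      using stefan_quotient_strict_mono[of \<eta> \<xi>] stefan_quotient_strict_mono[of \<xi> \<eta>] ex \<eta>
      by (cases \<eta> \<xi> rule: linorder_cases) auto
  qed
qed

section \<open>Caputo derivatives of the similarity profile and of the front\<close>

text \<open>This is where the stable density enters the problem: it is the time derivative of the
  profile, hence what the Caputo integral acts on.\<close>

lemma similarity_deriv_t:
  assumes t: "0 < t" and l: "0 < l"
  shows "((\<lambda>\<tau>. Wright (- (x / (l * \<tau> powr \<nu>))) (- \<nu>) 1) has_real_derivative stable_density \<nu> 0 (x / l) t) (at t)"
proof -
  let ?z = "- (x / l * t powr (- \<nu>))"
  have "((\<lambda>\<tau>. Wright (- (x / l * \<tau> powr (- \<nu>))) (- \<nu>) 1) has_real_derivative
      Wright ?z (- \<nu>) (1 - \<nu>) * (x / l * \<nu> * t powr (- \<nu> - 1))) (at t)"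
    using \<nu> t l by (intro DERIV_chain2[OF has_derivative_Wright]) (auto intro!: derivative_eq_intros)
  moreover have "- \<nu> - 1 = - 1 - \<nu>" by simp
  ultimately show ?thesis
    unfolding stable_density_0_eq[OF \<nu>] by (simp add: powr_minus_divide mult_ac)
qed

lemma caputo_similarity:
  assumes "0 < x" "0 < l" "0 < t"
  shows "has_caputo_deriv (2 * \<nu>) (\<lambda>\<tau>. A - B * (1 - Wright (- (x / (l * \<tau> powr \<nu>))) (- \<nu>) 1)) t
           (B * stable_density \<nu> (1 - 2 * \<nu>) (x / l) t)"
proof -
  let ?T = "\<lambda>\<tau>. A - B * (1 - Wright (- (x / (l * \<tau> powr \<nu>))) (- \<nu>) 1)"
  have D: "(?T has_real_derivative B * stable_density \<nu> 0 (x / l) \<tau>) (at \<tau>)" if "0 < \<tau>" for \<tau>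
    by (rule derivative_eq_intros similarity_deriv_t[OF that assms(2)] refl)+ simp
  have "((\<lambda>\<tau>. B * (stable_density \<nu> 0 (x / l) \<tau> / (t - \<tau>) powr (2 * \<nu>))) has_integral
      B * (Gamma (1 - 2 * \<nu>) * stable_density \<nu> (1 - 2 * \<nu>) (x / l) t)) {0..t}"
    using \<nu> assms by (intro has_integral_mult_right fractional_integral_has_integral) auto
  hence "((\<lambda>\<tau>. deriv ?T \<tau> / (t - \<tau>) powr (2 * \<nu>)) has_integral
      B * (Gamma (1 - 2 * \<nu>) * stable_density \<nu> (1 - 2 * \<nu>) (x / l) t)) {0..t}"
    by (rule has_integral_spike_finite[of "{0}", rotated 2]) (auto simp: DERIV_imp_deriv[OF D])
  moreover have "?T differentiable (at \<tau>)" if "0 < \<tau>" for \<tau>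
    unfolding real_differentiable_def using D[OF that] by (rule exI)
  ultimately show ?thesis
    unfolding has_caputo_deriv_def by (auto simp: mult_ac)
qed

text \<open>After scaling to the unit interval this is a Beta integral. The result is a multiple of
  \<open>t powr (- \<nu>)\<close>, the same power as the heat flux at the front, so the Stefan
  condition becomes an equation between constants.\<close>

lemma caputo_powr:
  assumes t: "0 < t"
  shows "has_caputo_deriv (2 * \<nu>) (\<lambda>\<tau>. c * \<tau> powr \<nu>) t (c * Gamma (1 + \<nu>) / Gamma (1 - \<nu>) * t powr (- \<nu>))"
proof -
  have D: "((\<lambda>\<tau>. c * \<tau> powr \<nu>) has_real_derivative c * \<nu> * \<tau> powr (\<nu> - 1)) (at \<tau>)" if "0 < \<tau>" for \<tau>
    using that by (auto intro!: derivative_eq_intros)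
  have "((\<lambda>v. v powr (\<nu> - 1) * (1 - v) powr (1 - 2 * \<nu> - 1)) has_integral Beta \<nu> (1 - 2 * \<nu>)) {0..1}"
    using \<nu> by (intro has_integral_Beta_real) auto
  note * = has_integral_stretch_real[OF this, of "1 / t"]
  have "((\<lambda>\<tau>. (\<tau> / t) powr (\<nu> - 1) * (1 - \<tau> / t) powr (- 2 * \<nu>)) has_integral t * Beta \<nu> (1 - 2 * \<nu>)) {0..t}"
  proof -
    have "(\<lambda>\<tau>. \<tau> * t) ` {0..1} = {0..t}"
    proof (intro equalityI subsetI)
      fix \<tau> assume "\<tau> \<in> {0..t}"
      thus "\<tau> \<in> (\<lambda>\<tau>. \<tau> * t) ` {0..1}" using t by (intro image_eqI[of _ _ "\<tau> / t"]) auto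
    qed (use t in \<open>auto simp: mult_le_cancel_right1\<close>)
    with * show ?thesis using t by simp
  qed
  \<comment> \<open>The factor restores what scaling extracts: \<open>t powr (\<nu> - 1)\<close>
    from the derivative and \<open>t powr (- 2 * \<nu>)\<close> from the singular weight.\<close>
  from has_integral_mult_right[OF this, of "c * \<nu> * t powr (- \<nu> - 1)"]
  have "((\<lambda>\<tau>. c * \<nu> * t powr (- \<nu> - 1) * ((\<tau> / t) powr (\<nu> - 1) * (1 - \<tau> / t) powr (- 2 * \<nu>)))
     has_integral c * \<nu> * t powr (- \<nu> - 1) * (t * Beta \<nu> (1 - 2 * \<nu>))) {0..t}" .
  hence "((\<lambda>\<tau>. deriv (\<lambda>\<tau>. c * \<tau> powr \<nu>) \<tau> / (t - \<tau>) powr (2 * \<nu>))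
     has_integral c * \<nu> * t powr (- \<nu> - 1) * (t * Beta \<nu> (1 - 2 * \<nu>))) {0..t}"
  proof (rule has_integral_spike_finite[of "{0, t}", rotated 2])
    fix \<tau> assume "\<tau> \<in> {0..t} - {0, t}"
    hence \<tau>: "0 < \<tau>" "\<tau> < t" by auto
    have "1 - \<tau> / t = (t - \<tau>) / t" using t by (simp add: field_simps)
    hence "t powr (- \<nu> - 1) * ((\<tau> / t) powr (\<nu> - 1) * (1 - \<tau> / t) powr (- 2 * \<nu>))
       = \<tau> powr (\<nu> - 1) / (t - \<tau>) powr (2 * \<nu>) * (t powr (- \<nu> - 1) / (t powr (\<nu> - 1) * t powr (- 2 * \<nu>)))"
      using \<tau> t by (simp add: powr_divide powr_minus_divide mult_ac)
    also have "t powr (\<nu> - 1) * t powr (- 2 * \<nu>) = t powr (- \<nu> - 1)"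
      by (simp add: powr_add[symmetric])
    finally show "deriv (\<lambda>\<tau>. c * \<tau> powr \<nu>) \<tau> / (t - \<tau>) powr (2 * \<nu>) =
       c * \<nu> * t powr (- \<nu> - 1) * ((\<tau> / t) powr (\<nu> - 1) * (1 - \<tau> / t) powr (- 2 * \<nu>))"
      using t by (simp add: DERIV_imp_deriv[OF D[OF \<tau>(1)]] mult.assoc)
  qed auto
  moreover have "c * \<nu> * t powr (- \<nu> - 1) * (t * Beta \<nu> (1 - 2 * \<nu>)) =
     Gamma (1 - 2 * \<nu>) * (c * Gamma (1 + \<nu>) / Gamma (1 - \<nu>) * t powr (- \<nu>))"
  proof -
    have "t powr (- \<nu> - 1) * t = t powr (- \<nu>)" using t by (simp add: powr_diff)
    moreover have "\<nu> \<notin> \<int>\<^sub>\<le>\<^sub>0" using \<nu> by (auto elim!: nonpos_Ints_cases)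
    hence "\<nu> * Gamma \<nu> = Gamma (1 + \<nu>)" using Gamma_plus1[of \<nu>] by (simp add: add.commute)
    moreover have "Beta \<nu> (1 - 2 * \<nu>) = Gamma \<nu> * Gamma (1 - 2 * \<nu>) / Gamma (1 - \<nu>)"
      by (simp add: Beta_def algebra_simps)
    ultimately have "c * (\<nu> * Gamma \<nu>) * (t powr (- \<nu> - 1) * t) * Gamma (1 - 2 * \<nu>) / Gamma (1 - \<nu>) =
       Gamma (1 - 2 * \<nu>) * (c * Gamma (1 + \<nu>) / Gamma (1 - \<nu>) * t powr (- \<nu>))"
      by (simp only:) simp
    thus ?thesis using \<open>Beta \<nu> (1 - 2 * \<nu>) = _\<close> by (simp add: mult_ac)
  qed
  moreover have "(\<lambda>\<tau>. c * \<tau> powr \<nu>) differentiable (at \<tau>)" if "0 < \<tau>" for \<tau>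
    unfolding real_differentiable_def using D[OF that] by (rule exI)
  ultimately show ?thesis
    unfolding has_caputo_deriv_def by auto
qed

end

text \<open>Each constant answers one condition: \<open>A\<close> puts the melting temperature on
  the front, \<open>l\<close> matches the prescribed flux at 0, and the equation for \<xi> is the
  Stefan condition. Writing the conductivity through \<open>l\<close> makes the diffusivity
  \<open>l\<^sup>2\<close>.\<close>

lemma stefan_problem_similarity:
  fixes \<nu> \<rho> c ell Tm T0 q0 \<xi> l A :: real
  assumes \<nu>: "0 < \<nu>" "\<nu> < 1/2" and pos: "0 < \<rho>" "0 < c" "0 < ell" "Tm < T0" "0 < q0" "0 < \<xi>"
    and eq: "\<xi> * A / Mainardi \<nu> \<xi> = c * (T0 - Tm) * Gamma (1 - \<nu>) / (ell * Gamma (1 + \<nu>))"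
    and A: "A = 1 - Wright (- \<xi>) (- \<nu>) 1"
    and l: "l = q0 * Gamma (1 - \<nu>) / (\<rho> * c * (T0 - Tm)) * A"
  shows "stefan_problem (2 * \<nu>) \<rho> (\<rho> * c * l\<^sup>2) c ell Tm T0 q0
     (\<lambda>x t. T0 - (T0 - Tm) / A * (1 - Wright (- (x / (l * t powr \<nu>))) (- \<nu>) 1))
     (\<lambda>t. l * \<xi> * t powr \<nu>)"
proof -
  let ?B = "(T0 - Tm) / A"
  let ?W = "\<lambda>b z. Wright z (- \<nu>) b"
  let ?T = "\<lambda>x t. T0 - ?B * (1 - ?W 1 (- (x / (l * t powr \<nu>))))"
  let ?s = "\<lambda>t. l * \<xi> * t powr \<nu>"
  have A0: "0 < A" using one_minus_Wright_pos[OF \<nu>] pos by (simp add: A)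
  have G0: "0 < Gamma (1 - \<nu>)" "0 < Gamma (1 + \<nu>)" using \<nu> by (auto intro: Gamma_real_pos)
  have l0: "0 < l" using A0 G0 pos by (auto simp: l intro!: mult_pos_pos divide_pos_pos)
  have M0: "0 < Mainardi \<nu> \<xi>" using Mainardi_pos[OF \<nu>] pos by simp
  have Tx: "((\<lambda>y. ?T y t) has_real_derivative - ?B / (l * t powr \<nu>) * Mainardi \<nu> (y / (l * t powr \<nu>))) (at y within S)"
    if "0 < t" for t y S
  proof -
    have "((\<lambda>y. 1 - ?W 1 (- (y / (l * t powr \<nu>)))) has_real_derivative Mainardi \<nu> (y / (l * t powr \<nu>)) * (1 / (l * t powr \<nu>))) (at y)"
      by (rule DERIV_chain2[OF one_minus_Wright_deriv[OF \<nu>]])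
         (use that l0 in \<open>auto intro!: derivative_eq_intros\<close>)
    from DERIV_diff[OF DERIV_const DERIV_cmult[OF this, of ?B], of T0]
    have "((\<lambda>y. ?T y t) has_real_derivative - ?B / (l * t powr \<nu>) * Mainardi \<nu> (y / (l * t powr \<nu>))) (at y)"
      by simp
    thus ?thesis by (rule has_field_derivative_at_within)
  qed
  have Txx: "(deriv (\<lambda>y. ?T y t) has_real_derivative ?B / (l * t powr \<nu>)\<^sup>2 * ?W (1 - 2 * \<nu>) (- (x / (l * t powr \<nu>)))) (at x)"
    if "0 < t" for t x
  proof -
    have "deriv (\<lambda>y. ?T y t) = (\<lambda>y. - ?B / (l * t powr \<nu>) * Mainardi \<nu> (y / (l * t powr \<nu>)))"
      using DERIV_imp_deriv[OF Tx[OF that, of _ UNIV]] by blast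
    moreover have "((\<lambda>y. Mainardi \<nu> (y / (l * t powr \<nu>))) has_real_derivative
        - ?W (1 - 2 * \<nu>) (- (x / (l * t powr \<nu>))) * (1 / (l * t powr \<nu>))) (at x)"
      by (rule DERIV_chain2[OF Mainardi_deriv[OF \<nu>]])
         (use that l0 in \<open>auto intro!: derivative_eq_intros\<close>)
    from DERIV_cmult[OF this, of "- ?B / (l * t powr \<nu>)"]
    have "((\<lambda>y. - ?B / (l * t powr \<nu>) * Mainardi \<nu> (y / (l * t powr \<nu>))) has_real_derivative
       ?B / (l * t powr \<nu>)\<^sup>2 * ?W (1 - 2 * \<nu>) (- (x / (l * t powr \<nu>)))) (at x)"
      by (simp add: power2_eq_square mult.assoc)
    ultimately show ?thesis by simp
  qed
  have T_s: "?T (?s t) t = Tm" if "0 < t" for t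
  proof -
    have "?s t / (l * t powr \<nu>) = \<xi>" using l0 that by simp
    hence "?T (?s t) t = T0 - ?B * A" by (simp add: A)
    thus ?thesis using A0 by simp
  qed
  show ?thesis unfolding stefan_problem_def
  proof (intro conjI allI impI; (elim conjE)?)
    fix t x :: real assume t: "0 < t" and x: "0 < x"
    show "\<forall>y\<in>{0<..<?s t}. (\<lambda>y. ?T y t) differentiable (at y)"
      using Tx[OF t, of _ UNIV] unfolding real_differentiable_def by blast
    show "\<exists>D. has_caputo_deriv (2 * \<nu>) (?T x) t D \<and>
        (deriv (\<lambda>y. ?T y t) has_real_derivative D / (\<rho> * c * l\<^sup>2 / (\<rho> * c))) (at x)"
    proof (intro exI conjI)
      show "has_caputo_deriv (2 * \<nu>) (?T x) t (?B * stable_density \<nu> (1 - 2 * \<nu>) (x / l) t)"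
        by (rule caputo_similarity[OF \<nu> x l0 t])
      \<comment> \<open>The time factor of the density is the one produced by two space derivatives;
        the remaining \<open>l\<^sup>2\<close> is the diffusivity.\<close>
      have "t powr (1 - 2 * \<nu> - 1) = (t powr (- \<nu>))\<^sup>2"
        by (simp add: power2_eq_square powr_add[symmetric])
      hence "?B * stable_density \<nu> (1 - 2 * \<nu>) (x / l) t / (\<rho> * c * l\<^sup>2 / (\<rho> * c))
          = ?B / (l * t powr \<nu>)\<^sup>2 * ?W (1 - 2 * \<nu>) (- (x / (l * t powr \<nu>)))"
        using pos t l0 by (simp add: stable_density_def powr_minus_divide power2_eq_square)
      thus "(deriv (\<lambda>y. ?T y t) has_real_derivative
          ?B * stable_density \<nu> (1 - 2 * \<nu>) (x / l) t / (\<rho> * c * l\<^sup>2 / (\<rho> * c))) (at x)"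
        using Txx[OF t, of x] by simp
    qed
  next
    show "?s 0 = 0" by simp
  next
    \<comment> \<open>At time 0 the front is at 0, as \<open>0 powr \<nu>\<close> is 0, so only the
      solid branch is evaluated and the profile at \<open>t = 0\<close> does not matter.\<close>
    fix x :: real assume "0 < x"
    thus "full_temp ?s ?T Tm x 0 = Tm" by (simp add: full_temp_def)
  next
    fix t :: real assume "0 < t"
    have "eventually (\<lambda>x. full_temp ?s ?T Tm x t = Tm) at_top"
      using eventually_ge_at_top[of "?s t"] by eventually_elim (simp add: full_temp_def)
    thus "((\<lambda>x. full_temp ?s ?T Tm x t) \<longlongrightarrow> Tm) at_top" by (rule tendsto_eventually)
  next
    fix t :: real assume "0 < t"
    thus "?T (?s t) t = Tm" by (rule T_s)
  next
    fix t :: real assume t: "0 < t"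
    have \<xi>: "?s t / (l * t powr \<nu>) = \<xi>" using l0 t by simp
    show "\<exists>Tx Ds. ((\<lambda>y. ?T y t) has_real_derivative Tx) (at (?s t) within {0..?s t}) \<and>
       has_caputo_deriv (2 * \<nu>) ?s t Ds \<and> - (\<rho> * c * l\<^sup>2) * Tx = \<rho> * ell * Ds"
    proof (intro exI conjI)
      show "((\<lambda>y. ?T y t) has_real_derivative - ?B / (l * t powr \<nu>) * Mainardi \<nu> \<xi>) (at (?s t) within {0..?s t})"
        using Tx[OF t, of "?s t"] unfolding \<xi> .
      show "has_caputo_deriv (2 * \<nu>) ?s t (l * \<xi> * Gamma (1 + \<nu>) / Gamma (1 - \<nu>) * t powr (- \<nu>))"
        by (rule caputo_powr[OF \<nu> t])
      \<comment> \<open>The equation for \<xi>, cleared of denominators, is the Stefan condition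
        without its common factor \<open>\<rho> * l * t powr (- \<nu>)\<close>.\<close>
      have "\<xi> * A * (ell * Gamma (1 + \<nu>)) = c * (T0 - Tm) * Gamma (1 - \<nu>) * Mainardi \<nu> \<xi>"
        using eq M0 pos G0 by (simp add: frac_eq_eq)
      hence "c * (T0 - Tm) * Mainardi \<nu> \<xi> / A = ell * \<xi> * Gamma (1 + \<nu>) / Gamma (1 - \<nu>)"
        using A0 G0 by (simp add: frac_eq_eq mult_ac)
      hence "\<rho> * l * t powr (- \<nu>) * (c * (T0 - Tm) * Mainardi \<nu> \<xi> / A)
          = \<rho> * l * t powr (- \<nu>) * (ell * \<xi> * Gamma (1 + \<nu>) / Gamma (1 - \<nu>))" by simp
      thus "- (\<rho> * c * l\<^sup>2) * (- ?B / (l * t powr \<nu>) * Mainardi \<nu> \<xi>) =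
          \<rho> * ell * (l * \<xi> * Gamma (1 + \<nu>) / Gamma (1 - \<nu>) * t powr (- \<nu>))"
        using l0 t by (simp add: powr_minus_divide power2_eq_square mult_ac)
    qed
  next
    fix t :: real assume "0 < t"
    show "?T 0 t = T0" by (simp add: Wright_0_arg)
  next
    fix t :: real assume t: "0 < t"
    \<comment> \<open>At the fixed face the slope involves \<open>Mainardi \<nu> 0\<close>, the
      reciprocal of \<open>Gamma (1 - \<nu>)\<close>; this is the origin of the Gamma factor in
      \<open>l\<close>.\<close>
    have "- ?B / (l * t powr \<nu>) * Mainardi \<nu> 0 = - q0 / t powr (2 * \<nu> / 2) / (\<rho> * c * l\<^sup>2)"
    proof -
      have "l * (\<rho> * c * (T0 - Tm)) = q0 * Gamma (1 - \<nu>) * A" using pos by (simp add: l)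
      hence "(T0 - Tm) / (A * Gamma (1 - \<nu>)) = q0 / (l * (\<rho> * c))" using A0 G0 l0 pos
        by (simp add: frac_eq_eq mult_ac)
      hence "(T0 - Tm) / (A * Gamma (1 - \<nu>)) * (1 / (l * t powr \<nu>)) = q0 / (l * (\<rho> * c)) * (1 / (l * t powr \<nu>))" by simp
      thus ?thesis by (simp add: Mainardi_0[OF \<nu>] power2_eq_square mult_ac)
    qed
    with Tx[OF t, of 0 "{0..?s t}"]
    show "((\<lambda>y. ?T y t) has_real_derivative - q0 / t powr (2 * \<nu> / 2) / (\<rho> * c * l\<^sup>2)) (at 0 within {0..?s t})"
      by simp
  qed
qed

theorem theorem6:
  fixes \<alpha> \<rho> c ell Tm T0 q0 :: real
  assumes "0 < \<alpha>" "\<alpha> < 1" "0 < \<rho>" "0 < c" "0 < ell" "Tm < T0" "0 < q0"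
  shows "(\<exists>!\<xi>. 0 < \<xi> \<and>
            \<xi> * (1 - Wright (- \<xi>) (- \<alpha> / 2) 1) / Mainardi (\<alpha> / 2) \<xi>
              = c * (T0 - Tm) * Gamma (1 - \<alpha> / 2) / (ell * Gamma (1 + \<alpha> / 2)))
       \<and> (\<forall>\<xi>. 0 < \<xi> \<and>
            \<xi> * (1 - Wright (- \<xi>) (- \<alpha> / 2) 1) / Mainardi (\<alpha> / 2) \<xi>
              = c * (T0 - Tm) * Gamma (1 - \<alpha> / 2) / (ell * Gamma (1 + \<alpha> / 2))
          \<longrightarrow> (let k = q0\<^sup>2 * (Gamma (1 - \<alpha> / 2))\<^sup>2 / (\<rho> * c * (T0 - Tm)\<^sup>2)
                      * (1 - Wright (- \<xi>) (- \<alpha> / 2) 1)\<^sup>2;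
                  lam = q0 * Gamma (1 - \<alpha> / 2) / (\<rho> * c * (T0 - Tm))
                      * (1 - Wright (- \<xi>) (- \<alpha> / 2) 1);
                  T = (\<lambda>x t. T0 - (T0 - Tm) / (1 - Wright (- \<xi>) (- \<alpha> / 2) 1)
                      * (1 - Wright (- (x / (lam * t powr (\<alpha> / 2)))) (- \<alpha> / 2) 1));
                  s = (\<lambda>t. lam * \<xi> * t powr (\<alpha> / 2))
              in stefan_problem \<alpha> \<rho> k c ell Tm T0 q0 T s))"
proof -
  define \<nu> where "\<nu> = \<alpha> / 2"
  have \<nu>: "0 < \<nu>" "\<nu> < 1/2" and \<alpha>: "\<alpha> = 2 * \<nu>" using assms by (auto simp: \<nu>_def)
  have [simp]: "- \<alpha> / 2 = - \<nu>" "\<alpha> / 2 = \<nu>" by (auto simp: \<nu>_def)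
  let ?K = "c * (T0 - Tm) * Gamma (1 - \<nu>) / (ell * Gamma (1 + \<nu>))"
  let ?A = "\<lambda>\<xi>. 1 - Wright (- \<xi>) (- \<nu>) 1"
  let ?l = "\<lambda>\<xi>. q0 * Gamma (1 - \<nu>) / (\<rho> * c * (T0 - Tm)) * ?A \<xi>"
  have "0 < ?K" using assms \<nu> by (intro divide_pos_pos mult_pos_pos Gamma_real_pos) auto
  note ex1 = stefan_equation_unique_solution[OF \<nu> this]
  have "stefan_problem \<alpha> \<rho> (q0\<^sup>2 * (Gamma (1 - \<nu>))\<^sup>2 / (\<rho> * c * (T0 - Tm)\<^sup>2) * (?A \<xi>)\<^sup>2) c ell Tm T0 q0
      (\<lambda>x t. T0 - (T0 - Tm) / ?A \<xi> * (1 - Wright (- (x / (?l \<xi> * t powr \<nu>))) (- \<nu>) 1))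
      (\<lambda>t. ?l \<xi> * \<xi> * t powr \<nu>)"
    if \<xi>: "0 < \<xi>" "\<xi> * ?A \<xi> / Mainardi \<nu> \<xi> = ?K" for \<xi>
  proof -
    \<comment> \<open>The stated conductivity is the one for which the diffusivity is the square of
      the stated \<lambda>.\<close>
    have "q0\<^sup>2 * (Gamma (1 - \<nu>))\<^sup>2 / (\<rho> * c * (T0 - Tm)\<^sup>2) * (?A \<xi>)\<^sup>2 = \<rho> * c * (?l \<xi>)\<^sup>2"
      using assms by (simp add: power_mult_distrib power_divide power2_eq_square mult_ac)
    thus ?thesis
      unfolding \<alpha> using stefan_problem_similarity[OF \<nu> assms(3-7) \<xi> refl refl] by simp
  qed
  with ex1 show ?thesis unfolding Let_def by simp
qed

end
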